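(* Let $G$ be a finite nilpotent group and let $\mu$ be a probability distribution on $G$ that is conjugacy invariant, i.e. $\mu(z^{-1}xz)=\mu(x)$ for all $x,z\in G$. Let $X=(X_t)_{t\ge 0}$ be the continuous-time rate-$1$ random walk on $G$ with jump distribution $\mu$, started at the identity, and assume that the walk is irreducible (so that its stationary distribution is the uniform distribution $\pi$ on $G$). Let $S=\{s_a: a\in[k]\}\subseteq G$ be a set containing exactly one representative of each conjugacy class of $G$ contained in $\operatorname{supp}(\mu)$, so that $\operatorname{supp}(\mu)=\bigsqcup_{a\in[k]}\mathrm{Cl}(s_a)$ with $k=|S|$, and let $\mu_*:=\min_{a\in[k]}\mu(\mathrm{Cl}(s_a))$. Then for every $\varepsilon\in(0,1)$, $$t_{\mathrm{mix}}^{\mathrm{TV}}(G_{\mathrm{ab}},\varepsilon)\;\le\; t_{\mathrm{mix}}^{\mathrm{TV}}(G,\varepsilon)\;\le\;\max\Big\{\,t_{\mathrm{mix}}^{\ell^2}(G_{\mathrm{ab}},\varepsilon/2),\ \mu_*^{-1}\big(\log k+2\log(4/\varepsilon)\big)\Big\}.$$ No reversibility (symmetry) of $\mu$ is assumed.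
   Context: Notation: $[k]=\{1,\dots,k\}$; $\mathrm{Cl}(s)=\{x^{-1}sx:x\in G\}$ is the conjugacy class of $s$; $[G,G]$ is the commutator subgroup and $G_{\mathrm{ab}}:=G/[G,G]$ is the abelianization. The walk: at the jump times of a rate-$1$ Poisson process the current state is right-multiplied by an independent element with distribution $\mu$. With $P(x,y)=\mu(x^{-1}y)$, its transition kernel is $P_t(x,y)=\sum_{m\ge 0}e^{-t}\frac{t^m}{m!}P^m(x,y)$. Irreducibility of the walk is equivalent to $S$ generating $G$. Mixing times on $G$, with $\pi$ uniform on $G$: $$t^{\mathrm{TV}}_{\mathrm{mix}}(G,\varepsilon):=\inf\{t\ge 0:\ \|P_t(\mathrm{id},\cdot)-\pi\|_{\mathrm{TV}}\le\varepsilon\},\qquad \|P_t(\mathrm{id},\cdot)-\pi\|_{\mathrm{TV}}=\tfrac12\sum_{x\in G}|P_t(\mathrm{id},x)-\pi(x)|,$$ $$t^{\ell^2}_{\mathrm{mix}}(G,\varepsilon):=\inf\Big\{t\ge 0:\ \Big\|\tfrac{P_t(\mathrm{id},\cdot)}{\pi(\cdot)}-1\Big\|_{2,\pi}\le\varepsilon\Big\},\qquad \|f\|_{2,\pi}=\Big(\sum_{x\in G}\pi(x)f(x)^2\Big)^{1/2}.$$ The projected walk $X^{\mathrm{ab}}_t:=[G,G]X_t$ is the rate-$1$ random walk on $G_{\mathrm{ab}}$ whose jump distribution is the push-forward of $\mu$ under $G\to G_{\mathrm{ab}}$, with uniform stationary distribution on $G_{\mathrm{ab}}$; $t^{\mathrm{TV}}_{\mathrm{mix}}(G_{\mathrm{ab}},\varepsilon)$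 and $t^{\ell^2}_{\mathrm{mix}}(G_{\mathrm{ab}},\varepsilon)$ are defined in the same way for $X^{\mathrm{ab}}$ and the uniform distribution on $G_{\mathrm{ab}}$. *)

theory Defs
  imports "HOL-Algebra.Generated_Groups" "HOL-Probability.Probability_Mass_Function"
begin

definition conj_class :: "('a, 'b) monoid_scheme \<Rightarrow> 'a \<Rightarrow> 'a set" where
  "conj_class G s = {inv\<^bsub>G\<^esub> x \<otimes>\<^bsub>G\<^esub> s \<otimes>\<^bsub>G\<^esub> x | x. x \<in> carrier G}"

text \<open>The subgroup \<open>[H, K]\<close>, with the commutator convention of \<^const>\<open>derived\<close>
  (so that \<open>[H, H]\<close> is \<open>derived G H\<close>).\<close>

definition commutator_subgroup :: "('a, 'b) monoid_scheme \<Rightarrow> 'a set \<Rightarrow> 'a set \<Rightarrow> 'a set" where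
  "commutator_subgroup G H K =
     generate G (\<Union>h\<in>H. \<Union>k\<in>K. {h \<otimes>\<^bsub>G\<^esub> k \<otimes>\<^bsub>G\<^esub> inv\<^bsub>G\<^esub> h \<otimes>\<^bsub>G\<^esub> inv\<^bsub>G\<^esub> k})"

primrec lower_central_series :: "('a, 'b) monoid_scheme \<Rightarrow> nat \<Rightarrow> 'a set" where
  "lower_central_series G 0 = carrier G"
| "lower_central_series G (Suc n) =
     commutator_subgroup G (lower_central_series G n) (carrier G)"

definition nilpotent_group :: "('a, 'b) monoid_scheme \<Rightarrow> bool" where
  "nilpotent_group G \<longleftrightarrow> group G \<and> (\<exists>n. lower_central_series G n = {\<one>\<^bsub>G\<^esub>})"

definition abelianization :: "('a, 'b) monoid_scheme \<Rightarrow> 'a set monoid" where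
  "abelianization G = G Mod derived G (carrier G)"

text \<open>A jump distribution on \<open>G\<close> is a pmf on the ambient type whose support lies in
  \<open>carrier G\<close>; the functions below are only meaningful for such \<open>\<mu>\<close> and for arguments
  in the carrier of a finite group.\<close>

definition ab_dist :: "('a, 'b) monoid_scheme \<Rightarrow> 'a pmf \<Rightarrow> 'a set pmf" where
  "ab_dist G \<mu> = map_pmf (\<lambda>x. derived G (carrier G) #>\<^bsub>G\<^esub> x) \<mu>"

definition jump_kernel :: "('a, 'b) monoid_scheme \<Rightarrow> 'a pmf \<Rightarrow> 'a \<Rightarrow> 'a \<Rightarrow> real" where
  "jump_kernel G \<mu> x y = pmf \<mu> (inv\<^bsub>G\<^esub> x \<otimes>\<^bsub>G\<^esub> y)"

primrec jump_kernel_pow :: "('a, 'b) monoid_scheme \<Rightarrow> 'a pmf \<Rightarrow> nat \<Rightarrow> 'a \<Rightarrow> 'a \<Rightarrow> real" where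
  "jump_kernel_pow G \<mu> 0 x y = (if x = y then 1 else 0)"
| "jump_kernel_pow G \<mu> (Suc m) x y =
     (\<Sum>z\<in>carrier G. jump_kernel_pow G \<mu> m x z * jump_kernel G \<mu> z y)"

text \<open>The number of jumps up to time \<open>t\<close> is Poisson with mean \<open>t\<close>; \<open>0 ^ 0 = 1\<close> makes the
  time-0 kernel the identity.\<close>

definition walk_kernel :: "('a, 'b) monoid_scheme \<Rightarrow> 'a pmf \<Rightarrow> real \<Rightarrow> 'a \<Rightarrow> 'a \<Rightarrow> real" where
  "walk_kernel G \<mu> t x y = (\<Sum>m. exp (- t) * (t ^ m / fact m) * jump_kernel_pow G \<mu> m x y)"

definition irreducible_walk :: "('a, 'b) monoid_scheme \<Rightarrow> 'a pmf \<Rightarrow> bool" where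
  "irreducible_walk G \<mu> \<longleftrightarrow>
     (\<forall>x\<in>carrier G. \<forall>y\<in>carrier G. \<exists>t\<ge>0. walk_kernel G \<mu> t x y > 0)"

definition uniform_mass :: "('a, 'b) monoid_scheme \<Rightarrow> 'a \<Rightarrow> real" where
  "uniform_mass G x = 1 / real (card (carrier G))"

definition tv_dist_unif :: "('a, 'b) monoid_scheme \<Rightarrow> 'a pmf \<Rightarrow> real \<Rightarrow> real" where
  "tv_dist_unif G \<mu> t =
     (1 / 2) * (\<Sum>x\<in>carrier G. \<bar>walk_kernel G \<mu> t \<one>\<^bsub>G\<^esub> x - uniform_mass G x\<bar>)"

definition l2_dist_unif :: "('a, 'b) monoid_scheme \<Rightarrow> 'a pmf \<Rightarrow> real \<Rightarrow> real" where
  "l2_dist_unif G \<mu> t =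
     sqrt (\<Sum>x\<in>carrier G. uniform_mass G x *
             (walk_kernel G \<mu> t \<one>\<^bsub>G\<^esub> x / uniform_mass G x - 1)\<^sup>2)"

text \<open>\<^const>\<open>Inf\<close> on the reals is unspecified on the empty set; for an irreducible walk on a
  finite group and \<open>\<epsilon> > 0\<close> the two sets below are nonempty, since both distances tend to \<open>0\<close>.\<close>

definition tv_mixing_time :: "('a, 'b) monoid_scheme \<Rightarrow> 'a pmf \<Rightarrow> real \<Rightarrow> real" where
  "tv_mixing_time G \<mu> \<epsilon> = Inf {t. t \<ge> 0 \<and> tv_dist_unif G \<mu> t \<le> \<epsilon>}"

definition l2_mixing_time :: "('a, 'b) monoid_scheme \<Rightarrow> 'a pmf \<Rightarrow> real \<Rightarrow> real" where
  "l2_mixing_time G \<mu> \<epsilon> = Inf {t. t \<ge> 0 \<and> l2_dist_unif G \<mu> t \<le> \<epsilon>}"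

end

theory Submission
  imports Defs
begin

text \<open>
  The law of the walk after \<open>m\<close> jumps is a sum, over words \<open>w\<close> of length \<open>m\<close> in \<open>S\<close>, of convolutions
  \<open>F\<^sub>w\<close> of the restrictions of \<open>\<mu>\<close> to single conjugacy classes. If every class occurs in \<open>w\<close>, then
  \<open>F\<^sub>w\<close> is constant on the cosets of \<open>[G, G]\<close>. To see this, let \<open>H\<close> be the group of left translations that
  preserve \<open>F\<^sub>w\<close> and suppose that \<open>H\<close> contains the \<open>(i + 1)\<close>-st term of the lower central series.
  For \<open>h\<close> in the \<open>(i - 1)\<close>-st term and \<open>s\<close> in the support of \<open>\<mu>\<close>, the commutator \<open>z = [h, s]\<close> is central modulo \<open>H\<close>
  and \<open>z s\<close> is conjugate to \<open>s\<close>; hence translation by \<open>z\<close> preserves the image in \<open>G / H\<close> of the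
  factor of \<open>F\<^sub>w\<close> that belongs to the class of \<open>s\<close>, and \<open>z \<in> H\<close>. Since the support generates \<open>G\<close>, the \<open>i\<close>-th term lies in \<open>H\<close>.

  By Poisson thinning, some class is still unused at time \<open>t\<close> with probability at most
  \<open>k exp (- t \<mu>\<^sub>*)\<close>, and this bounds the distance between the law of the walk and its average over
  cosets of \<open>[G, G]\<close>. The total variation distance of that average to uniform is the one
  on \<open>G\<^sub>a\<^sub>b\<close>, which is at most half the \<open>\<ell>\<^sup>2\<close> distance.
\<close>

subsection \<open>Convolution on a group\<close>

context group
begin

lemma inv_mult_cancel:
  "x \<in> carrier G \<Longrightarrow> y \<in> carrier G \<Longrightarrow> inv x \<otimes> (x \<otimes> y) = y"
  "x \<in> carrier G \<Longrightarrow> y \<in> carrier G \<Longrightarrow> x \<otimes> (inv x \<otimes> y) = y"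
  by (simp_all flip: m_assoc)

text \<open>As simp rules these right-associate products, push inverses inwards and cancel
  neighbouring inverse pairs, so that both sides of a word identity reach the same normal
  form.\<close>

lemmas group_normal_form = m_assoc inv_mult_group inv_mult_cancel

lemma bij_betw_left_mult: "a \<in> carrier G \<Longrightarrow> bij_betw (\<lambda>u. a \<otimes> u) (carrier G) (carrier G)"
  by (rule bij_betw_byWitness[where f' = "\<lambda>u. inv a \<otimes> u"]) (auto simp: group_normal_form)

lemma bij_betw_conj: "a \<in> carrier G \<Longrightarrow> bij_betw (\<lambda>u. inv a \<otimes> u \<otimes> a) (carrier G) (carrier G)"
  by (rule bij_betw_byWitness[where f' = "\<lambda>u. a \<otimes> u \<otimes> inv a"]) (auto simp: group_normal_form)

lemma bij_betw_inv_mult: "a \<in> carrier G \<Longrightarrow> bij_betw (\<lambda>u. inv u \<otimes> a) (carrier G) (carrier G)"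
  by (rule bij_betw_byWitness[where f' = "\<lambda>u. a \<otimes> inv u"]) (auto simp: group_normal_form)

lemma bij_betw_mult_inv: "a \<in> carrier G \<Longrightarrow> bij_betw (\<lambda>u. a \<otimes> inv u) (carrier G) (carrier G)"
  by (rule bij_betw_byWitness[where f' = "\<lambda>u. inv u \<otimes> a"]) (auto simp: group_normal_form)

definition conv :: "('a \<Rightarrow> real) \<Rightarrow> ('a \<Rightarrow> real) \<Rightarrow> 'a \<Rightarrow> real" where
  "conv f g y = (\<Sum>u\<in>carrier G. f u * g (inv u \<otimes> y))"

definition class_function :: "('a \<Rightarrow> real) \<Rightarrow> bool" where
  "class_function f \<longleftrightarrow> (\<forall>x\<in>carrier G. \<forall>z\<in>carrier G. f (inv z \<otimes> x \<otimes> z) = f x)"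

lemma class_functionD:
  "class_function f \<Longrightarrow> x \<in> carrier G \<Longrightarrow> z \<in> carrier G \<Longrightarrow> f (inv z \<otimes> x \<otimes> z) = f x"
  by (simp add: class_function_def)

lemma conv_cong:
  assumes "\<And>x. x \<in> carrier G \<Longrightarrow> f x = f' x" "\<And>x. x \<in> carrier G \<Longrightarrow> g x = g' x" "y \<in> carrier G"
  shows "conv f g y = conv f' g' y"
  unfolding conv_def using assms by (auto intro!: sum.cong)

lemma conv_nonneg:
  assumes "\<And>x. x \<in> carrier G \<Longrightarrow> 0 \<le> f x" "\<And>x. x \<in> carrier G \<Longrightarrow> 0 \<le> g x" "y \<in> carrier G"
  shows "0 \<le> conv f g y"
  unfolding conv_def using assms by (auto intro!: sum_nonneg)

lemma sum_left_translate:
  fixes f :: "'a \<Rightarrow> real"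
  shows "a \<in> carrier G \<Longrightarrow> (\<Sum>u\<in>carrier G. f (a \<otimes> u)) = sum f (carrier G)"
  by (rule sum.reindex_bij_betw[OF bij_betw_left_mult])

text \<open>The substitution \<open>u -> y u^-1\<close> exchanges the factors; \<open>u^-1 y\<close>
  and \<open>y u^-1\<close> are conjugate by \<open>u\<close>, which the class function
  \<open>g\<close> does not see. Class functions are thus central for convolution.\<close>

lemma conv_commute:
  assumes "class_function g" "y \<in> carrier G"
  shows "conv f g y = conv g f y"
proof -
  have "conv g f y = (\<Sum>u\<in>carrier G. g (y \<otimes> inv u) * f (inv (y \<otimes> inv u) \<otimes> y))"
    unfolding conv_def
    by (rule sum.reindex_bij_betw[OF bij_betw_mult_inv[OF assms(2)], symmetric])
  also have "\<dots> = conv f g y"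
    unfolding conv_def
  proof (rule sum.cong)
    fix u assume u: "u \<in> carrier G"
    have "g (inv u \<otimes> y) = g (inv u \<otimes> (y \<otimes> inv u) \<otimes> u)"
      using u assms(2) by (simp add: group_normal_form)
    also have "\<dots> = g (y \<otimes> inv u)"
      using u assms by (intro class_functionD) auto
    finally show "g (y \<otimes> inv u) * f (inv (y \<otimes> inv u) \<otimes> y) = f u * g (inv u \<otimes> y)"
      using u assms(2) by (simp add: group_normal_form)
  qed simp
  finally show ?thesis by simp
qed

lemma class_function_conv:
  assumes "class_function f" "class_function g"
  shows "class_function (conv f g)"
  unfolding class_function_def
proof safe
  fix x z assume xz: "x \<in> carrier G" "z \<in> carrier G"
  have "conv f g (inv z \<otimes> x \<otimes> z) =
     (\<Sum>u\<in>carrier G. f (inv z \<otimes> u \<otimes> z) * g (inv (inv z \<otimes> u \<otimes> z) \<otimes> (inv z \<otimes> x \<otimes> z)))"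
    unfolding conv_def
    by (rule sum.reindex_bij_betw[OF bij_betw_conj[OF xz(2)], symmetric])
  also have "\<dots> = conv f g x"
    unfolding conv_def
  proof (rule sum.cong)
    fix u assume u: "u \<in> carrier G"
    have "inv (inv z \<otimes> u \<otimes> z) \<otimes> (inv z \<otimes> x \<otimes> z) = inv z \<otimes> (inv u \<otimes> x) \<otimes> z"
      using u xz by (simp add: group_normal_form)
    then show "f (inv z \<otimes> u \<otimes> z) * g (inv (inv z \<otimes> u \<otimes> z) \<otimes> (inv z \<otimes> x \<otimes> z))
      = f u * g (inv u \<otimes> x)"
      using u xz assms by (simp add: class_functionD)
  qed simp
  finally show "conv f g (inv z \<otimes> x \<otimes> z) = conv f g x" .
qed

lemma conv_assoc:
  assumes y: "y \<in> carrier G"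
  shows "conv (conv f g) h y = conv f (conv g h) y"
proof -
  have "conv (conv f g) h y
      = (\<Sum>v\<in>carrier G. \<Sum>u\<in>carrier G. f v * g (inv v \<otimes> u) * h (inv u \<otimes> y))"
    unfolding conv_def by (subst sum.swap) (simp add: sum_distrib_right)
  also have "\<dots> = (\<Sum>v\<in>carrier G. \<Sum>w\<in>carrier G. f v * g w * h (inv w \<otimes> (inv v \<otimes> y)))"
  proof (rule sum.cong)
    fix v assume v: "v \<in> carrier G"
    have "(\<Sum>u\<in>carrier G. f v * g (inv v \<otimes> u) * h (inv u \<otimes> y))
      = (\<Sum>w\<in>carrier G. f v * g (inv v \<otimes> (v \<otimes> w)) * h (inv (v \<otimes> w) \<otimes> y))"
      by (rule sum_left_translate[OF v, symmetric])
    also have "\<dots> = (\<Sum>w\<in>carrier G. f v * g w * h (inv w \<otimes> (inv v \<otimes> y)))"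
      using v y by (auto intro!: sum.cong simp: group_normal_form)
    finally show "(\<Sum>u\<in>carrier G. f v * g (inv v \<otimes> u) * h (inv u \<otimes> y))
      = (\<Sum>w\<in>carrier G. f v * g w * h (inv w \<otimes> (inv v \<otimes> y)))" .
  qed simp
  also have "\<dots> = conv f (conv g h) y"
    unfolding conv_def by (simp add: sum_distrib_left mult.assoc)
  finally show ?thesis .
qed

lemma sum_conv:
  "(\<Sum>y\<in>carrier G. conv f g y) = sum f (carrier G) * sum g (carrier G)"
proof -
  have "(\<Sum>y\<in>carrier G. conv f g y)
      = (\<Sum>u\<in>carrier G. f u * (\<Sum>y\<in>carrier G. g (inv u \<otimes> y)))"
    unfolding conv_def by (subst sum.swap) (simp add: sum_distrib_left)
  also have "\<dots> = (\<Sum>u\<in>carrier G. f u * sum g (carrier G))"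
    by (intro sum.cong refl) (simp add: sum_left_translate)
  finally show ?thesis by (simp add: sum_distrib_right)
qed

lemma conv_diff_right: "conv f (\<lambda>x. g x - h x) y = conv f g y - conv f h y"
  by (simp add: conv_def right_diff_distrib sum_subtractf)

lemma conv_sum:
  "conv (\<lambda>x. \<Sum>a\<in>A. f a x) (\<lambda>x. \<Sum>b\<in>B. g b x) y = (\<Sum>b\<in>B. \<Sum>a\<in>A. conv (f a) (g b) y)"
proof -
  have "conv (\<lambda>x. \<Sum>a\<in>A. f a x) (\<lambda>x. \<Sum>b\<in>B. g b x) y
      = (\<Sum>u\<in>carrier G. \<Sum>b\<in>B. \<Sum>a\<in>A. f a u * g b (inv u \<otimes> y))"
    by (simp add: conv_def sum_product sum.swap[of _ A B])
  also have "\<dots> = (\<Sum>b\<in>B. \<Sum>a\<in>A. conv (f a) (g b) y)"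
    unfolding conv_def by (subst sum.swap) (intro sum.cong refl sum.swap)
  finally show ?thesis .
qed

section \<open>Convolution along words\<close>

primrec word_conv :: "('i \<Rightarrow> 'a \<Rightarrow> real) \<Rightarrow> 'i list \<Rightarrow> 'a \<Rightarrow> real" where
  "word_conv f [] y = (if y = \<one> then 1 else 0)"
| "word_conv f (a # w) y = conv (f a) (word_conv f w) y"

lemma word_conv_nonneg:
  assumes "\<And>a x. a \<in> set w \<Longrightarrow> x \<in> carrier G \<Longrightarrow> 0 \<le> f a x" "y \<in> carrier G"
  shows "0 \<le> word_conv f w y"
  using assms by (induction w arbitrary: y) (auto intro!: conv_nonneg)

lemma sum_word_conv:
  assumes "finite (carrier G)"
  shows "(\<Sum>y\<in>carrier G. word_conv f w y) = (\<Prod>a\<leftarrow>w. \<Sum>y\<in>carrier G. f a y)"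
  using assms by (induction w) (simp_all add: sum_conv sum.delta)

lemma class_function_word_conv:
  assumes "\<And>a. a \<in> set w \<Longrightarrow> class_function (f a)"
  shows "class_function (word_conv f w)"
  using assms
proof (induction w)
  case Nil
  have "inv z \<otimes> x \<otimes> z = \<one> \<longleftrightarrow> x = \<one>" if "x \<in> carrier G" "z \<in> carrier G" for x z
  proof
    assume "inv z \<otimes> x \<otimes> z = \<one>"
    then have "z \<otimes> (inv z \<otimes> x \<otimes> z) \<otimes> inv z = \<one>" using that by simp
    then show "x = \<one>" using that by (simp add: group_normal_form)
  qed (use that in auto)
  then show ?case by (auto simp: class_function_def)
next
  case (Cons a w)
  then have "class_function (conv (f a) (word_conv f w))"
    by (intro class_function_conv) auto
  moreover have "word_conv f (a # w) = conv (f a) (word_conv f w)" by auto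
  ultimately show ?case by metis
qed

text \<open>Since class functions are central, the factor of one occurrence of \<open>s\<close> can
  be moved to the front; \<open>R\<close> is the convolution along the remaining letters.\<close>

lemma word_conv_factor:
  assumes "s \<in> set w" "\<And>a. a \<in> set w \<Longrightarrow> class_function (f a)"
  obtains R where "\<And>y. y \<in> carrier G \<Longrightarrow> word_conv f w y = conv (f s) R y"
  using assms
proof (induction w arbitrary: thesis)
  case Nil
  then show ?case by simp
next
  case (Cons a w)
  show ?case
  proof (cases "a = s")
    case True
    then show ?thesis using Cons.prems(1)[of "word_conv f w"] by simp
  next
    case False
    then have "s \<in> set w" using Cons.prems by auto
    then obtain R where R: "\<And>y. y \<in> carrier G \<Longrightarrow> word_conv f w y = conv (f s) R y"
      using Cons.IH Cons.prems by auto
    have "word_conv f (a # w) y = conv (f s) (conv (f a) R) y" if y: "y \<in> carrier G" for y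
    proof -
      have "word_conv f (a # w) y = conv (f a) (conv (f s) R) y"
        using y R by (auto intro!: conv_cong)
      also have "\<dots> = conv (conv (f a) (f s)) R y" by (rule conv_assoc[OF y, symmetric])
      also have "\<dots> = conv (conv (f s) (f a)) R y"
        using Cons.prems(2,3) y by (auto intro!: conv_cong conv_commute)
      also have "\<dots> = conv (f s) (conv (f a) R) y" by (rule conv_assoc[OF y])
      finally show ?thesis .
    qed
    then show ?thesis by (rule Cons.prems(1))
  qed
qed

text \<open>Young's inequality: Cauchy-Schwarz with weights \<open>r u\<close>, then summation over
  \<open>y\<close>, where convolution multiplies total masses. It yields both the monotonicity of
  the l2 distance and the Doeblin contraction.\<close>

lemma sum_conv_squares_le:
  assumes r: "\<And>u. u \<in> carrier G \<Longrightarrow> 0 \<le> r u"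
  shows "(\<Sum>y\<in>carrier G. (conv r h y)\<^sup>2) \<le> (sum r (carrier G))\<^sup>2 * (\<Sum>y\<in>carrier G. (h y)\<^sup>2)"
proof -
  have pointwise: "(conv r h y)\<^sup>2 \<le> sum r (carrier G) * conv r (\<lambda>y. (h y)\<^sup>2) y" for y
  proof -
    have "conv r h y = (\<Sum>u\<in>carrier G. sqrt (r u) * (sqrt (r u) * h (inv u \<otimes> y)))"
      unfolding conv_def by (intro sum.cong) (auto simp: r simp flip: mult.assoc)
    then have "(conv r h y)\<^sup>2 \<le> (\<Sum>u\<in>carrier G. (sqrt (r u))\<^sup>2)
        * (\<Sum>u\<in>carrier G. (sqrt (r u) * h (inv u \<otimes> y))\<^sup>2)"
      by (simp add: Cauchy_Schwarz_ineq_sum)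
    also have "\<dots> = sum r (carrier G) * conv r (\<lambda>y. (h y)\<^sup>2) y"
      unfolding conv_def by (simp add: r power_mult_distrib)
    finally show ?thesis .
  qed
  have "(\<Sum>y\<in>carrier G. (conv r h y)\<^sup>2)
      \<le> (\<Sum>y\<in>carrier G. sum r (carrier G) * conv r (\<lambda>y. (h y)\<^sup>2) y)"
    by (intro sum_mono pointwise)
  also have "\<dots> = (sum r (carrier G))\<^sup>2 * (\<Sum>y\<in>carrier G. (h y)\<^sup>2)"
    by (simp only: sum_conv power2_eq_square mult.assoc flip: sum_distrib_left)
  finally show ?thesis .
qed

section \<open>Conjugacy classes and averages over translates\<close>

lemma conj_class_conj:
  assumes "x \<in> carrier G" "z \<in> carrier G" "s \<in> carrier G"
  shows "inv z \<otimes> x \<otimes> z \<in> conj_class G s \<longleftrightarrow> x \<in> conj_class G s"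
proof
  assume "inv z \<otimes> x \<otimes> z \<in> conj_class G s"
  then obtain g where g: "g \<in> carrier G" "inv z \<otimes> x \<otimes> z = inv g \<otimes> s \<otimes> g"
    by (auto simp: conj_class_def)
  have "x = z \<otimes> (inv z \<otimes> x \<otimes> z) \<otimes> inv z" using assms by (simp add: group_normal_form)
  also have "\<dots> = inv (g \<otimes> inv z) \<otimes> s \<otimes> (g \<otimes> inv z)"
    unfolding g(2) using assms g(1) by (simp add: group_normal_form)
  finally show "x \<in> conj_class G s" using assms g by (auto simp: conj_class_def)
next
  assume "x \<in> conj_class G s"
  then obtain g where g: "g \<in> carrier G" "x = inv g \<otimes> s \<otimes> g" by (auto simp: conj_class_def)
  then have "inv z \<otimes> x \<otimes> z = inv (g \<otimes> z) \<otimes> s \<otimes> (g \<otimes> z)"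
    using assms by (simp add: group_normal_form)
  then show "inv z \<otimes> x \<otimes> z \<in> conj_class G s" using assms g by (auto simp: conj_class_def)
qed

lemma conj_class_subset: "s \<in> carrier G \<Longrightarrow> conj_class G s \<subseteq> carrier G"
  by (auto simp: conj_class_def)

lemma conj_class_self: "s \<in> carrier G \<Longrightarrow> s \<in> conj_class G s"
  by (auto simp: conj_class_def intro!: exI[of _ \<one>])

lemma conj_class_eq:
  assumes "u \<in> conj_class G s" "s \<in> carrier G"
  shows "conj_class G u = conj_class G s"
proof -
  obtain g where g: "g \<in> carrier G" "u = inv g \<otimes> s \<otimes> g" using assms by (auto simp: conj_class_def)
  have subset: "conj_class G u \<subseteq> conj_class G s" if u: "u \<in> conj_class G s" and s: "s \<in> carrier G" for u s
  proof
    fix x assume "x \<in> conj_class G u"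
    then obtain z where z: "z \<in> carrier G" "x = inv z \<otimes> u \<otimes> z" by (auto simp: conj_class_def[of G u])
    have "u \<in> carrier G" using conj_class_subset[OF s] u by blast
    then show "x \<in> conj_class G s" using conj_class_conj[OF _ z(1) s] u z(2) by simp
  qed
  have u: "u \<in> carrier G" using g assms by simp
  have "s = inv (inv g) \<otimes> u \<otimes> inv g" using g assms by (simp add: group_normal_form)
  then have "s \<in> conj_class G u" using g unfolding conj_class_def by blast
  then show ?thesis using subset[OF assms] subset[OF _ u] by blast
qed

text \<open>For a subgroup \<open>D\<close> this is the mean over the right coset
  \<open>D x\<close>. With \<open>D = [G, G]\<close> it projects onto the functions that factor
  through the abelianization.\<close>

definition coset_average :: "'a set \<Rightarrow> ('a \<Rightarrow> real) \<Rightarrow> 'a \<Rightarrow> real" where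
  "coset_average D F x = (\<Sum>d\<in>D. F (d \<otimes> x)) / card D"

lemma coset_average_sum:
  "coset_average D (\<lambda>x. \<Sum>a\<in>A. F a x) x = (\<Sum>a\<in>A. coset_average D (F a) x)"
  unfolding coset_average_def by (subst sum.swap) (simp add: sum_divide_distrib)

lemma sum_coset_average:
  assumes D: "D \<subseteq> carrier G" "card D \<noteq> 0"
  shows "(\<Sum>x\<in>carrier G. coset_average D F x) = (\<Sum>x\<in>carrier G. F x)"
proof -
  have "(\<Sum>x\<in>carrier G. coset_average D F x) = (\<Sum>d\<in>D. \<Sum>x\<in>carrier G. F (d \<otimes> x)) / card D"
    unfolding coset_average_def by (subst sum.swap) (simp add: sum_divide_distrib)
  also have "(\<Sum>d\<in>D. \<Sum>x\<in>carrier G. F (d \<otimes> x)) = (\<Sum>d\<in>D. \<Sum>x\<in>carrier G. F x)"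
    using D by (intro sum.cong refl sum_left_translate) auto
  finally show ?thesis using D by simp
qed

text \<open>Averaging preserves positivity and total mass, so the triangle inequality suffices. This
  crude bound serves the words in which some class is missing.\<close>

lemma sum_abs_diff_coset_average_le:
  assumes D: "D \<subseteq> carrier G" "card D \<noteq> 0" and F: "\<And>x. x \<in> carrier G \<Longrightarrow> 0 \<le> F x"
  shows "(\<Sum>x\<in>carrier G. \<bar>F x - coset_average D F x\<bar>) \<le> 2 * sum F (carrier G)"
proof -
  have "(\<Sum>x\<in>carrier G. \<bar>F x - coset_average D F x\<bar>) \<le> (\<Sum>x\<in>carrier G. F x + coset_average D F x)"
  proof (rule sum_mono)
    fix x assume x: "x \<in> carrier G"
    have "0 \<le> coset_average D F x"
      unfolding coset_average_def using D x F by (auto intro!: divide_nonneg_nonneg sum_nonneg)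
    then show "\<bar>F x - coset_average D F x\<bar> \<le> F x + coset_average D F x" using F[OF x] by linarith
  qed
  then show ?thesis using sum_coset_average[OF D, of F] by (simp add: sum.distrib)
qed

subsection \<open>Translation invariance in nilpotent groups\<close>

text \<open>If the commutator \<open>z\<close> of \<open>h\<close> and \<open>s\<close> is central modulo \<open>H\<close>, then \<open>z s\<close> is conjugate to \<open>s\<close>,
  so left multiplication by \<open>z\<close> permutes the image of the class of \<open>s\<close> in \<open>G / H\<close>.\<close>

lemma class_average_translate:
  fixes f :: "'a \<Rightarrow> real"
  assumes fin: "finite (carrier G)" and H: "H \<lhd> G" and f: "class_function f"
    and supp: "\<And>u. u \<in> carrier G \<Longrightarrow> f u \<noteq> 0 \<Longrightarrow> u \<in> conj_class G s"
    and s: "s \<in> carrier G" and h: "h \<in> carrier G"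
    and z_def: "z = h \<otimes> s \<otimes> inv h \<otimes> inv s"
    and central: "\<And>g. g \<in> carrier G \<Longrightarrow> z \<otimes> g \<otimes> inv z \<otimes> inv g \<in> H"
    and v: "v \<in> carrier G"
  shows "(\<Sum>a\<in>H. f (a \<otimes> (z \<otimes> v))) = (\<Sum>a\<in>H. f (a \<otimes> v))"
proof -
  interpret H: normal H G by (rule H)
  \<comment> \<open>\<open>E\<close> is the push-forward of \<open>f\<close> to
    \<open>G / H\<close>, lifted back to \<open>G\<close>: \<open>E_left\<close> says that it is
    constant on cosets of \<open>H\<close>, \<open>E_conj\<close> that it is again a class
    function.\<close>
  define E where "E = (\<lambda>v. \<Sum>a\<in>H. f (a \<otimes> v))"
  have z: "z \<in> carrier G" using s h by (simp add: z_def)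
  have E_left: "E (b \<otimes> v) = E v" if "b \<in> H" "v \<in> carrier G" for b v
  proof -
    have "bij_betw (\<lambda>a. a \<otimes> b) H H"
      by (rule bij_betw_byWitness[where f' = "\<lambda>u. u \<otimes> inv b"]) (use that in \<open>auto simp: m_assoc\<close>)
    then have "E v = (\<Sum>a\<in>H. f (a \<otimes> b \<otimes> v))"
      unfolding E_def by (rule sum.reindex_bij_betw[symmetric])
    also have "\<dots> = E (b \<otimes> v)"
      unfolding E_def using that by (auto intro!: sum.cong simp: m_assoc)
    finally show ?thesis by simp
  qed
  have E_conj: "E (inv g \<otimes> v \<otimes> g) = E v" if "g \<in> carrier G" "v \<in> carrier G" for g v
  proof -
    have "bij_betw (\<lambda>a. inv g \<otimes> a \<otimes> g) H H"
      by (rule bij_betw_byWitness[where f' = "\<lambda>u. g \<otimes> u \<otimes> inv g"])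
        (use that H.inv_op_closed1 H.inv_op_closed2 in \<open>auto simp: group_normal_form\<close>)
    then have "E (inv g \<otimes> v \<otimes> g) = (\<Sum>a\<in>H. f ((inv g \<otimes> a \<otimes> g) \<otimes> (inv g \<otimes> v \<otimes> g)))"
      unfolding E_def by (rule sum.reindex_bij_betw[symmetric])
    also have "\<dots> = (\<Sum>a\<in>H. f (inv g \<otimes> (a \<otimes> v) \<otimes> g))"
      using that by (auto intro!: sum.cong simp: group_normal_form)
    also have "\<dots> = E v"
      unfolding E_def using that by (auto intro!: sum.cong class_functionD[OF f])
    finally show ?thesis .
  qed
  \<comment> \<open>A point of the support of \<open>E\<close> is conjugate to \<open>s\<close>
    modulo \<open>H\<close>, so \<open>E s\<close> is the only possible nonzero value. As
    \<open>z\<close> is central modulo \<open>H\<close>, \<open>z v\<close> is conjugate modulo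
    \<open>H\<close> to \<open>z s = h s h^-1\<close>, hence again to \<open>s\<close>.\<close>
  have support: "E v = E s \<and> E (z \<otimes> v) = E s" if Ev: "E v \<noteq> 0" and v: "v \<in> carrier G" for v
  proof -
    obtain a where a: "a \<in> H" "f (a \<otimes> v) \<noteq> 0"
      using Ev unfolding E_def by (elim sum.not_neutral_contains_not_neutral)
    then obtain x where x: "x \<in> carrier G" "a \<otimes> v = inv x \<otimes> s \<otimes> x"
      using supp[of "a \<otimes> v"] v by (auto simp: conj_class_def)
    have v_eq: "v = inv a \<otimes> (inv x \<otimes> s \<otimes> x)"
      using a(1) v by (simp add: group_normal_form flip: x(2))
    \<comment> \<open>The error in \<open>H\<close> made by moving \<open>z\<close> past
      \<open>a^-1\<close> and \<open>x^-1\<close>: a conjugate of \<open>a^-1\<close> times a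
      commutator covered by \<open>central\<close>.\<close>
    define b where "b = (z \<otimes> inv a \<otimes> inv z) \<otimes> (z \<otimes> inv x \<otimes> inv z \<otimes> inv (inv x))"
    have b: "b \<in> H"
      unfolding b_def using a(1) z x(1) central[of "inv x"] H.inv_op_closed2[of z "inv a"] by auto
    have "z \<otimes> v = b \<otimes> (inv x \<otimes> (z \<otimes> s) \<otimes> x)"
      unfolding v_eq b_def using a(1) s x(1) z by (simp add: group_normal_form)
    moreover have "z \<otimes> s = inv (inv h) \<otimes> s \<otimes> inv h"
      unfolding z_def using s h by (simp add: group_normal_form)
    ultimately have "E (z \<otimes> v) = E s"
      using E_left[OF b] E_conj[of "inv h" s] E_conj[of x "inv (inv h) \<otimes> s \<otimes> inv h"] x(1) h s by simp
    moreover have "E v = E s"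
      unfolding v_eq using E_left[of "inv a"] E_conj a(1) x(1) s by simp
    ultimately show ?thesis by simp
  qed
  \<comment> \<open>\<open>support\<close> only shows that \<open>z\<close> maps the support of
    \<open>E\<close> into itself. An injection of a finite set into itself is onto, so points
    outside the support stay outside as well.\<close>
  define V where "V = {v \<in> carrier G. E v \<noteq> 0}"
  have z_V: "(\<lambda>v. z \<otimes> v) ` V = V"
  proof (rule endo_inj_surj)
    show "finite V" using fin by (simp add: V_def)
    show "(\<lambda>v. z \<otimes> v) ` V \<subseteq> V" using z support by (auto simp: V_def)
    show "inj_on (\<lambda>v. z \<otimes> v) V" using z by (auto simp: V_def inj_on_def)
  qed
  have "E (z \<otimes> v) = 0" if "E v = 0"
  proof (rule ccontr)
    assume "E (z \<otimes> v) \<noteq> 0"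
    then have "z \<otimes> v \<in> V" using v z by (simp add: V_def)
    then have "z \<otimes> v \<in> (\<lambda>v. z \<otimes> v) ` V" using z_V by simp
    then obtain w where w: "w \<in> V" "z \<otimes> v = z \<otimes> w" by auto
    then have "v = w"
      using inj_onD[OF bij_betw_imp_inj_on[OF bij_betw_left_mult[OF z]]] v by (simp add: V_def)
    then show False using w(1) that by (simp add: V_def)
  qed
  then have "E (z \<otimes> v) = E v" using support[of v] v by (cases "E v = 0") auto
  then show ?thesis by (simp add: E_def)
qed

text \<open>Since \<open>F\<close> is invariant under \<open>H\<close>, summing over
  \<open>H\<close> only scales \<open>F\<close> but replaces the factor \<open>f\<close> by its
  push-forward \<open>E\<close>; a shift of the summation variable then moves \<open>z\<close> onto
  \<open>E\<close>, which absorbs it.\<close>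

lemma conv_translate:
  fixes F :: "'a \<Rightarrow> real"
  assumes fin: "finite (carrier G)" and H: "subgroup H G"
    and F: "\<And>y. y \<in> carrier G \<Longrightarrow> F y = conv f R y"
    and F_H: "\<And>a y. a \<in> H \<Longrightarrow> y \<in> carrier G \<Longrightarrow> F (a \<otimes> y) = F y"
    and z: "z \<in> carrier G"
    and average: "\<And>v. v \<in> carrier G \<Longrightarrow> (\<Sum>a\<in>H. f (a \<otimes> (z \<otimes> v))) = (\<Sum>a\<in>H. f (a \<otimes> v))"
    and y: "y \<in> carrier G"
  shows "F (z \<otimes> y) = F y"
proof -
  interpret H: subgroup H G by (rule H)
  define E where "E = (\<lambda>v. \<Sum>a\<in>H. f (a \<otimes> v))"
  have "card H \<noteq> 0"
    using H.one_closed finite_subset[OF H.subset fin] card_0_eq by blast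
  have F_E: "real (card H) * F y = conv E R y" if y: "y \<in> carrier G" for y
  proof -
    have "real (card H) * F y = (\<Sum>a\<in>H. F (a \<otimes> y))" using F_H y by simp
    also have "\<dots> = (\<Sum>a\<in>H. \<Sum>v\<in>carrier G. f (a \<otimes> v) * R (inv v \<otimes> y))"
    proof (rule sum.cong)
      fix a assume a: "a \<in> H"
      have "F (a \<otimes> y) = (\<Sum>v\<in>carrier G. f (a \<otimes> v) * R (inv (a \<otimes> v) \<otimes> (a \<otimes> y)))"
        using a y F[of "a \<otimes> y"] by (simp add: conv_def
          sum_left_translate[where f = "\<lambda>u. f u * R (inv u \<otimes> (a \<otimes> y))"])
      also have "\<dots> = (\<Sum>v\<in>carrier G. f (a \<otimes> v) * R (inv v \<otimes> y))"
        using a y by (auto intro!: sum.cong simp: group_normal_form)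
      finally show "F (a \<otimes> y) = (\<Sum>v\<in>carrier G. f (a \<otimes> v) * R (inv v \<otimes> y))" .
    qed simp
    also have "\<dots> = conv E R y"
      unfolding conv_def E_def by (subst sum.swap) (simp add: sum_distrib_right)
    finally show ?thesis .
  qed
  have "conv E R (z \<otimes> y) = (\<Sum>v\<in>carrier G. E (z \<otimes> v) * R (inv (z \<otimes> v) \<otimes> (z \<otimes> y)))"
    unfolding conv_def by (rule sum_left_translate[OF z, symmetric])
  also have "\<dots> = conv E R y"
    unfolding conv_def using z y average
    by (auto intro!: sum.cong simp: group_normal_form E_def)
  finally have "real (card H) * F (z \<otimes> y) = real (card H) * F y"
    using F_E[OF y] F_E[of "z \<otimes> y"] z y by simp
  then show ?thesis using \<open>card H \<noteq> 0\<close> by simp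
qed

text \<open>For a class function, translation by \<open>g h g^-1\<close> is translation by
  \<open>h\<close> after conjugating the argument by \<open>g\<close>. Normality is what allows
  working in the quotient by the stabilizer.\<close>

lemma normal_stabilizer:
  fixes F :: "'a \<Rightarrow> real"
  assumes F: "class_function F"
  shows "{h \<in> carrier G. \<forall>y\<in>carrier G. F (h \<otimes> y) = F y} \<lhd> G" (is "?H \<lhd> G")
proof (rule normal_invI)
  show "subgroup ?H G"
  proof (rule subgroupI)
    fix a assume "a \<in> ?H"
    then have a: "a \<in> carrier G" "\<And>y. y \<in> carrier G \<Longrightarrow> F (a \<otimes> y) = F y" by auto
    have "F (inv a \<otimes> y) = F y" if "y \<in> carrier G" for y
      using a(2)[of "inv a \<otimes> y"] a(1) that by (simp add: group_normal_form)
    then show "inv a \<in> ?H" using a by auto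
  next
    show "?H \<noteq> {}" by (auto intro!: exI[of _ \<one>])
  qed (auto simp: m_assoc)
next
  fix g h assume g: "g \<in> carrier G" and h: "h \<in> ?H"
  have "F (g \<otimes> h \<otimes> inv g \<otimes> y) = F y" if y: "y \<in> carrier G" for y
  proof -
    have "F (g \<otimes> h \<otimes> inv g \<otimes> y) = F (inv g \<otimes> (g \<otimes> h \<otimes> inv g \<otimes> y) \<otimes> g)"
      using g h y by (subst class_functionD[OF F]) auto
    also have "\<dots> = F (h \<otimes> (inv g \<otimes> y \<otimes> g))"
      using g h y by (simp add: group_normal_form)
    also have "\<dots> = F (inv g \<otimes> y \<otimes> g)" using g h y by auto
    also have "\<dots> = F y" using g y by (intro class_functionD[OF F]) auto
    finally show ?thesis .
  qed
  then show "g \<otimes> h \<otimes> inv g \<in> ?H" using g h by auto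
qed

section \<open>Climbing the lower central series\<close>

lemma lower_central_series_subset: "lower_central_series G n \<subseteq> carrier G"
proof (induction n)
  case (Suc n)
  then show ?case
    unfolding lower_central_series.simps commutator_subgroup_def
    by (intro generate_incl) (auto simp: subset_iff)
qed simp

lemma commutator_in_lower_central_series:
  assumes "h \<in> lower_central_series G n" "g \<in> carrier G"
  shows "h \<otimes> g \<otimes> inv h \<otimes> inv g \<in> lower_central_series G (Suc n)"
  using assms by (auto simp: commutator_subgroup_def intro!: generate.incl)

lemma commutator_subgroup_subset:
  assumes "subgroup H G" "\<And>a b. a \<in> A \<Longrightarrow> b \<in> B \<Longrightarrow> a \<otimes> b \<otimes> inv a \<otimes> inv b \<in> H"
  shows "commutator_subgroup G A B \<subseteq> H"
  unfolding commutator_subgroup_def using assms(2)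
  by (intro generate_subgroup_incl[OF _ assms(1)]) auto

text \<open>Each element of \<open>U\<close> supplies one factor \<open>f\<close> of \<open>F\<close>; this is what allows the stabilizer of \<open>F\<close>
  to climb up the lower central series.\<close>

lemma derived_translate_class_function:
  fixes F :: "'a \<Rightarrow> real"
  assumes fin: "finite (carrier G)" and nil: "nilpotent_group G" and F: "class_function F"
    and U: "U \<subseteq> carrier G"
    and gen: "\<And>K. \<one> \<in> K \<Longrightarrow> (\<And>x u. x \<in> K \<Longrightarrow> x \<in> carrier G \<Longrightarrow> u \<in> U \<Longrightarrow> x \<otimes> u \<in> K)
                \<Longrightarrow> carrier G \<subseteq> K"
    and factor: "\<And>s. s \<in> U \<Longrightarrow> \<exists>f R. class_function f
                \<and> (\<forall>u\<in>carrier G. f u \<noteq> 0 \<longrightarrow> u \<in> conj_class G s)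
                \<and> (\<forall>y\<in>carrier G. F y = conv f R y)"
    and d: "d \<in> derived G (carrier G)" and y: "y \<in> carrier G"
  shows "F (d \<otimes> y) = F y"
proof -
  define H where "H = {h \<in> carrier G. \<forall>y\<in>carrier G. F (h \<otimes> y) = F y}"
  have H: "H \<lhd> G" unfolding H_def by (rule normal_stabilizer[OF F])
  interpret H: normal H G by (rule H)
  have F_H: "F (a \<otimes> y) = F y" if "a \<in> H" "y \<in> carrier G" for a y
    using that unfolding H_def by blast
  note sub = lower_central_series_subset
  \<comment> \<open>The hypothesis makes the term of index \<open>Suc i\<close> central modulo
    \<open>H\<close>. That term is generated by the commutators of elements \<open>h\<close> of the
    term of index \<open>i\<close> with \<open>G\<close>, so only these have to be placed in
    \<open>H\<close>.\<close>
  have step: "lower_central_series G (Suc i) \<subseteq> H"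
    if IH: "lower_central_series G (Suc (Suc i)) \<subseteq> H" for i
    unfolding lower_central_series.simps(2)[of G i]
  proof (rule commutator_subgroup_subset[OF H.subgroup_axioms])
    fix h k assume h: "h \<in> lower_central_series G i" and k: "k \<in> carrier G"
    have hG: "h \<in> carrier G" using h sub by auto
    have U_H: "h \<otimes> s \<otimes> inv h \<otimes> inv s \<in> H" if s: "s \<in> U" for s
    proof -
      define z where "z = h \<otimes> s \<otimes> inv h \<otimes> inv s"
      have sG: "s \<in> carrier G" using s U by auto
      have z: "z \<in> lower_central_series G (Suc i)"
        unfolding z_def by (rule commutator_in_lower_central_series[OF h sG])
      then have zG: "z \<in> carrier G" by (rule subsetD[OF sub])
      have central: "z \<otimes> g \<otimes> inv z \<otimes> inv g \<in> H" if "g \<in> carrier G" for g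
        by (rule subsetD[OF IH commutator_in_lower_central_series[OF z that]])
      obtain f R where f: "class_function f"
        "\<And>u. u \<in> carrier G \<Longrightarrow> f u \<noteq> 0 \<Longrightarrow> u \<in> conj_class G s"
        and F_eq: "\<And>y. y \<in> carrier G \<Longrightarrow> F y = conv f R y"
        using factor[OF s] by blast
      have "F (z \<otimes> y) = F y" if "y \<in> carrier G" for y
        by (rule conv_translate[OF fin H.subgroup_axioms F_eq F_H zG
              class_average_translate[OF fin H f sG hG z_def central] that])
      then show ?thesis unfolding z_def[symmetric] H_def using zG by auto
    qed
    \<comment> \<open>For fixed \<open>h\<close> the set \<open>?K\<close> is closed under right
      multiplication by \<open>U\<close>, since \<open>[h, x u] = [h, x] (x [h, u] x^-1)\<close> and
      \<open>H\<close> is normal; \<open>gen\<close> then extends the inclusion from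
      \<open>U\<close> to \<open>G\<close>.\<close>
    have "carrier G \<subseteq> {k \<in> carrier G. h \<otimes> k \<otimes> inv h \<otimes> inv k \<in> H}" (is "_ \<subseteq> ?K")
    proof (rule gen)
      show "\<one> \<in> ?K" using hG by simp
      fix x u assume x: "x \<in> ?K" and u: "u \<in> U"
      have uG: "u \<in> carrier G" using u U by auto
      have "h \<otimes> (x \<otimes> u) \<otimes> inv h \<otimes> inv (x \<otimes> u)
          = (h \<otimes> x \<otimes> inv h \<otimes> inv x) \<otimes> (x \<otimes> (h \<otimes> u \<otimes> inv h \<otimes> inv u) \<otimes> inv x)"
        using x uG hG by (simp add: group_normal_form)
      also have "\<dots> \<in> H" using x U_H[OF u] by (auto intro!: H.inv_op_closed2)
      finally show "x \<otimes> u \<in> ?K" using x uG by simp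
    qed
    then show "h \<otimes> k \<otimes> inv h \<otimes> inv k \<in> H" using k by auto
  qed
  obtain n where n: "lower_central_series G n = {\<one>}" using nil by (auto simp: nilpotent_group_def)
  \<comment> \<open>The series stays trivial once it is trivial. Starting at \<open>Suc n\<close>
    covers the case \<open>n = 0\<close>, because \<open>step\<close> speaks of positive indices
    only.\<close>
  have "commutator_subgroup G {\<one>} (carrier G) \<subseteq> {\<one>}"
    by (intro commutator_subgroup_subset triv_subgroup) auto
  then have "lower_central_series G (Suc n) \<subseteq> H" using n by auto
  then have "lower_central_series G (Suc 0) \<subseteq> H"
    using step by (induction n) auto
  moreover have "lower_central_series G (Suc 0) = derived G (carrier G)"
    by (simp add: commutator_subgroup_def derived_def)
  ultimately show ?thesis using F_H d y by blast
qed

end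

subsection \<open>Convergence of the continuous-time walk\<close>

definition poisson_weight :: "real \<Rightarrow> nat \<Rightarrow> real" where
  "poisson_weight t m = exp (- t) * (t ^ m / fact m)"

lemma poisson_weight_nonneg: "0 \<le> t \<Longrightarrow> 0 \<le> poisson_weight t m"
  by (simp add: poisson_weight_def)

text \<open>The Poisson generating function. At \<open>r = 1\<close> it gives total mass one; at
  \<open>r = 1 - p\<close> it is the probability that a Poisson process thinned to rate
  \<open>p\<close> has no point up to time \<open>t\<close>.\<close>

lemma poisson_weight_power_sums: "(\<lambda>m. poisson_weight t m * r ^ m) sums exp (- (t * (1 - r)))"
proof -
  have "(\<lambda>m. exp (- t) * ((t * r) ^ m /\<^sub>R fact m)) sums (exp (- t) * exp (t * r))"
    by (intro sums_mult exp_converges)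
  moreover have "exp (- t) * exp (t * r) = exp (- (t * (1 - r)))"
    by (simp add: algebra_simps flip: exp_add)
  moreover have "(\<lambda>m. exp (- t) * ((t * r) ^ m /\<^sub>R fact m)) = (\<lambda>m. poisson_weight t m * r ^ m)"
    by (simp add: poisson_weight_def fun_eq_iff power_mult_distrib field_simps)
  ultimately show ?thesis by simp
qed

lemma poisson_weight_sums: "poisson_weight t sums 1"
  using poisson_weight_power_sums[of t 1] by simp

lemma poisson_weight_add:
  "poisson_weight (s + t) k = (\<Sum>i\<le>k. poisson_weight s i * poisson_weight t (k - i))"
proof -
  have "poisson_weight (s + t) k = exp (- s) * exp (- t) * ((s + t) ^ k / fact k)"
    by (simp add: poisson_weight_def flip: exp_add)
  also have "(s + t) ^ k / fact k = (\<Sum>i\<le>k. s ^ i / fact i * (t ^ (k - i) / fact (k - i)))"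
    by (simp add: binomial_ring sum_divide_distrib binomial_fact field_simps)
  finally show ?thesis
    by (simp add: poisson_weight_def sum_distrib_left mult_ac)
qed

text \<open>Expands a power of a sum. For an alphabet with one letter removed, it gives the total
  weight of the words of length \<open>m\<close> that avoid this letter.\<close>

lemma sum_prod_list_words:
  fixes p :: "'i \<Rightarrow> real"
  shows "(\<Sum>w\<in>{w. set w \<subseteq> A \<and> length w = m}. \<Prod>a\<leftarrow>w. p a) = (sum p A) ^ m"
proof (induction m)
  case 0
  have "{w. set w \<subseteq> A \<and> length w = 0} = {[]}" by auto
  then show ?case by auto
next
  case (Suc m)
  have "(\<Sum>w\<in>{w. set w \<subseteq> A \<and> length w = Suc m}. \<Prod>a\<leftarrow>w. p a)
     = (\<Sum>w\<in>{w. set w \<subseteq> A \<and> length w = m}. \<Sum>a\<in>A. p a * (\<Prod>a\<leftarrow>w. p a))"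
    unfolding lists_length_Suc_eq
    by (subst sum.reindex) (auto simp: inj_on_def sum.cartesian_product split_def)
  then show ?case by (simp add: Suc flip: sum_distrib_left sum_distrib_right)
qed

section \<open>Laws of the walk and their semigroup property\<close>

locale group_walk = group G for G :: "('a, 'b) monoid_scheme" (structure) +
  fixes \<mu> :: "'a pmf"
  assumes finite_carrier [simp]: "finite (carrier G)"
    and supp_subset: "set_pmf \<mu> \<subseteq> carrier G"
begin

abbreviation law :: "nat \<Rightarrow> 'a \<Rightarrow> real" where
  "law m \<equiv> jump_kernel_pow G \<mu> m \<one>"

abbreviation walk_law :: "real \<Rightarrow> 'a \<Rightarrow> real" where
  "walk_law t \<equiv> walk_kernel G \<mu> t \<one>"

lemma law_Suc: "law (Suc m) y = conv (law m) (pmf \<mu>) y"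
  by (simp add: conv_def jump_kernel_def)

lemma sum_pmf: "sum (pmf \<mu>) (carrier G) = 1"
  by (rule sum_pmf_eq_1) (simp_all add: supp_subset)

lemma carrier_nonempty [simp]: "carrier G \<noteq> {}"
  using one_closed by blast

lemma card_pos: "0 < card (carrier G)"
  by (simp add: card_gt_0_iff)

lemma law_nonneg: "y \<in> carrier G \<Longrightarrow> 0 \<le> law m y"
  by (induction m arbitrary: y) (auto simp: jump_kernel_def intro!: sum_nonneg)

lemma sum_law: "sum (law m) (carrier G) = 1"
proof (induction m)
  case (Suc m)
  then show ?case using sum_conv[of "law m" "pmf \<mu>"] by (simp only: law_Suc sum_pmf mult_1)
qed simp

lemma law_le_1: "y \<in> carrier G \<Longrightarrow> law m y \<le> 1"
  using member_le_sum[of y "carrier G" "law m"] law_nonneg by (simp add: sum_law)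

lemma law_add: "y \<in> carrier G \<Longrightarrow> law (m + n) y = conv (law m) (law n) y"
proof (induction n arbitrary: y)
  case 0
  have "conv (law m) (law 0) y = (\<Sum>u\<in>carrier G. if u = y then law m u else 0)"
    unfolding conv_def
  proof (rule sum.cong)
    fix u assume "u \<in> carrier G"
    then have "\<one> = inv u \<otimes> y \<longleftrightarrow> u = y"
      using 0 by (metis inv_closed inv_equality inv_inv l_inv)
    then show "law m u * law 0 (inv u \<otimes> y) = (if u = y then law m u else 0)" by simp
  qed simp
  then show ?case using 0 by (simp del: jump_kernel_pow.simps)
next
  case (Suc n)
  have "law (m + Suc n) y = conv (law (m + n)) (pmf \<mu>) y"
    using law_Suc[of "m + n" y] by simp
  also have "\<dots> = conv (conv (law m) (law n)) (pmf \<mu>) y"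
    using Suc by (intro conv_cong) auto
  also have "\<dots> = conv (law m) (conv (law n) (pmf \<mu>)) y" by (rule conv_assoc[OF Suc.prems])
  also have "\<dots> = conv (law m) (law (Suc n)) y"
    using Suc.prems by (intro conv_cong) (auto simp only: law_Suc)
  finally show ?case .
qed

text \<open>\<open>walk_kernel\<close> is a bare infinite sum, so its value is usable only once
  summability is known; this follows by comparison with the Poisson weights.\<close>

lemma walk_law_sums:
  assumes "0 \<le> t" "y \<in> carrier G"
  shows "(\<lambda>m. poisson_weight t m * law m y) sums walk_law t y"
proof -
  have "summable (\<lambda>m. poisson_weight t m * law m y)"
  proof (rule summable_comparison_test'[OF sums_summable[OF poisson_weight_sums[of t]]])
    fix n show "norm (poisson_weight t n * law n y) \<le> poisson_weight t n"
      using assms law_nonneg law_le_1 poisson_weight_nonneg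
      by (simp add: abs_mult mult_left_le)
  qed
  then show ?thesis
    unfolding walk_kernel_def poisson_weight_def by (rule summable_sums)
qed

lemma walk_law_nonneg: "0 \<le> t \<Longrightarrow> y \<in> carrier G \<Longrightarrow> 0 \<le> walk_law t y"
  by (rule sums_le[OF _ sums_zero walk_law_sums]) (auto intro!: mult_nonneg_nonneg law_nonneg poisson_weight_nonneg)

lemma sum_walk_law:
  assumes "0 \<le> t"
  shows "sum (walk_law t) (carrier G) = 1"
proof -
  have "(\<lambda>m. \<Sum>y\<in>carrier G. poisson_weight t m * law m y) sums sum (walk_law t) (carrier G)"
    using assms by (intro sums_sum walk_law_sums) auto
  then have "poisson_weight t sums sum (walk_law t) (carrier G)"
    by (simp add: sum_law flip: sum_distrib_left)
  then show ?thesis using poisson_weight_sums sums_unique2 by blast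
qed

text \<open>The Chapman-Kolmogorov equation: the two series are multiplied as a Cauchy product, and
  each diagonal collapses by \<open>law_add\<close> and \<open>poisson_weight_add\<close>.\<close>

lemma walk_law_add:
  assumes s: "0 \<le> s" and t: "0 \<le> t" and y: "y \<in> carrier G"
  shows "walk_law (s + t) y = conv (walk_law s) (walk_law t) y"
proof -
  have summable: "summable (\<lambda>m. norm (poisson_weight t m * law m y))"
    if "0 \<le> t" "y \<in> carrier G" for t y
    using sums_summable[OF walk_law_sums[OF that]] that
    by (simp add: abs_mult law_nonneg poisson_weight_nonneg)
  have "(\<lambda>k. \<Sum>u\<in>carrier G. \<Sum>i\<le>k. (poisson_weight s i * law i u)
          * (poisson_weight t (k - i) * law (k - i) (inv u \<otimes> y)))
      sums conv (walk_law s) (walk_law t) y"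
    unfolding conv_def
  proof (rule sums_sum)
    fix u assume u: "u \<in> carrier G"
    then have "(\<lambda>k. \<Sum>i\<le>k. (poisson_weight s i * law i u)
          * (poisson_weight t (k - i) * law (k - i) (inv u \<otimes> y)))
      sums ((\<Sum>m. poisson_weight s m * law m u) * (\<Sum>m. poisson_weight t m * law m (inv u \<otimes> y)))"
      using s t y by (intro Cauchy_product_sums summable) auto
    then show "(\<lambda>k. \<Sum>i\<le>k. (poisson_weight s i * law i u)
          * (poisson_weight t (k - i) * law (k - i) (inv u \<otimes> y)))
      sums (walk_law s u * walk_law t (inv u \<otimes> y))"
      by (simp add: walk_kernel_def poisson_weight_def)
  qed
  moreover have "(\<Sum>u\<in>carrier G. \<Sum>i\<le>k. (poisson_weight s i * law i u)
          * (poisson_weight t (k - i) * law (k - i) (inv u \<otimes> y)))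
      = poisson_weight (s + t) k * law k y" for k
  proof -
    have "(\<Sum>u\<in>carrier G. \<Sum>i\<le>k. (poisson_weight s i * law i u)
          * (poisson_weight t (k - i) * law (k - i) (inv u \<otimes> y)))
      = (\<Sum>i\<le>k. poisson_weight s i * poisson_weight t (k - i) * conv (law i) (law (k - i)) y)"
      unfolding conv_def by (subst sum.swap) (simp add: sum_distrib_left mult_ac)
    also have "\<dots> = (\<Sum>i\<le>k. poisson_weight s i * poisson_weight t (k - i) * law k y)"
      by (intro sum.cong refl) (simp add: y flip: law_add)
    finally show ?thesis by (simp add: poisson_weight_add sum_distrib_right)
  qed
  ultimately have "(\<lambda>k. poisson_weight (s + t) k * law k y) sums conv (walk_law s) (walk_law t) y"
    by simp
  moreover have "(\<lambda>k. poisson_weight (s + t) k * law k y) sums walk_law (s + t) y"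
    using s t y by (intro walk_law_sums) auto
  ultimately show ?thesis using sums_unique2 by blast
qed

section \<open>Deviation from the uniform distribution\<close>

definition excess :: "real \<Rightarrow> 'a \<Rightarrow> real" where
  "excess t x = walk_law t x - uniform_mass G x"

lemma sum_uniform_mass: "sum (uniform_mass G) (carrier G) = 1"
  using card_pos by (simp add: uniform_mass_def)

text \<open>Convolution with a probability law fixes the uniform distribution, so the deviation
  evolves under the same semigroup.\<close>

lemma excess_add:
  assumes "0 \<le> s" "0 \<le> t" "y \<in> carrier G"
  shows "excess (s + t) y = conv (walk_law s) (excess t) y"
proof -
  have "conv (walk_law s) (uniform_mass G) y = uniform_mass G y"
    using assms sum_walk_law[of s] by (simp add: conv_def uniform_mass_def flip: sum_divide_distrib)
  then show ?thesis
    using assms unfolding excess_def by (simp add: walk_law_add conv_diff_right)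
qed

lemma l2_dist_unif_eq:
  "l2_dist_unif G \<mu> t = sqrt (card (carrier G) * (\<Sum>x\<in>carrier G. (excess t x)\<^sup>2))"
proof -
  have "uniform_mass G x * (walk_law t x / uniform_mass G x - 1)\<^sup>2 = card (carrier G) * (excess t x)\<^sup>2" for x
    using card_pos by (simp add: uniform_mass_def excess_def field_simps power2_eq_square)
  then show ?thesis by (simp add: l2_dist_unif_def sum_distrib_left)
qed

lemma tv_dist_unif_eq: "tv_dist_unif G \<mu> t = (\<Sum>x\<in>carrier G. \<bar>excess t x\<bar>) / 2"
  by (simp add: tv_dist_unif_def excess_def)

lemma tv_dist_unif_le_l2: "tv_dist_unif G \<mu> t \<le> l2_dist_unif G \<mu> t / 2"
proof -
  have "(\<Sum>x\<in>carrier G. \<bar>excess t x\<bar>)\<^sup>2 \<le> card (carrier G) * (\<Sum>x\<in>carrier G. (excess t x)\<^sup>2)"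
    using Cauchy_Schwarz_ineq_sum[of "\<lambda>x. 1" "\<lambda>x. \<bar>excess t x\<bar>" "carrier G"] by simp
  then have "(\<Sum>x\<in>carrier G. \<bar>excess t x\<bar>) \<le> l2_dist_unif G \<mu> t"
    unfolding l2_dist_unif_eq by (rule real_le_rsqrt)
  then show ?thesis by (simp add: tv_dist_unif_eq)
qed

text \<open>Convolution with a probability law does not increase the l2 norm. Monotonicity carries a
  bound at one time to all later times, which is how the infimum in the mixing time is
  exploited.\<close>

lemma l2_dist_unif_antimono:
  assumes "0 \<le> s" "s \<le> t"
  shows "l2_dist_unif G \<mu> t \<le> l2_dist_unif G \<mu> s"
proof -
  have "(\<Sum>x\<in>carrier G. (excess t x)\<^sup>2) = (\<Sum>x\<in>carrier G. (conv (walk_law (t - s)) (excess s) x)\<^sup>2)"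
    using assms excess_add[of "t - s" s] by simp
  also have "\<dots> \<le> (\<Sum>x\<in>carrier G. (excess s x)\<^sup>2)"
    using sum_conv_squares_le[of "walk_law (t - s)" "excess s"] assms
    by (simp add: sum_walk_law walk_law_nonneg)
  finally show ?thesis
    unfolding l2_dist_unif_eq by (simp add: mult_left_mono)
qed

lemma irreducible_walk_law_pos:
  assumes irr: "irreducible_walk G \<mu>" and y: "y \<in> carrier G"
  obtains m where "0 < law m y"
proof -
  obtain t where t: "0 \<le> t" "0 < walk_law t y"
    using irr y by (auto simp: irreducible_walk_def)
  have "\<exists>m. 0 < law m y"
  proof (rule ccontr)
    assume "\<not> (\<exists>m. 0 < law m y)"
    then have "law m y = 0" for m using law_nonneg[OF y, of m] by (metis less_eq_real_def)
    then have "(\<lambda>m. 0) sums walk_law t y" using walk_law_sums[OF t(1) y] by simp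
    then show False using t(2) sums_unique2[OF sums_zero] by fastforce
  qed
  then show ?thesis using that by blast
qed

text \<open>For \<open>t > 0\<close> every number of jumps has positive Poisson weight, so one
  suitable number of jumps suffices. The time in \<open>irreducible_walk\<close>, which may depend
  on the states, is thereby replaced by any positive time.\<close>

lemma walk_law_pos:
  assumes irr: "irreducible_walk G \<mu>" and y: "y \<in> carrier G" and t: "0 < t"
  shows "0 < walk_law t y"
proof -
  obtain m where m: "0 < law m y" by (rule irreducible_walk_law_pos[OF irr y])
  have "(\<lambda>n. if n = m then poisson_weight t m * law m y else 0) sums (poisson_weight t m * law m y)"
    by (rule sums_single)
  then have "poisson_weight t m * law m y \<le> walk_law t y"
    using t y by (intro sums_le[OF _ _ walk_law_sums])
      (auto intro!: mult_nonneg_nonneg law_nonneg poisson_weight_nonneg)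
  moreover have "0 < poisson_weight t m * law m y"
    using m t by (simp add: poisson_weight_def)
  ultimately show ?thesis by linarith
qed

lemma sum_excess:
  assumes "0 \<le> t"
  shows "sum (excess t) (carrier G) = 0"
  using assms by (simp add: excess_def sum_subtractf sum_walk_law sum_uniform_mass)

text \<open>Doeblin's argument: \<open>walk_law 1\<close> exceeds a positive constant \<open>c\<close>, and convolution with a constant
  annihilates functions of total mass zero.\<close>

lemma exists_l2_dist_unif_le:
  assumes pos: "\<And>x. x \<in> carrier G \<Longrightarrow> 0 < walk_law 1 x" and e: "0 < e"
  shows "\<exists>t\<ge>0. l2_dist_unif G \<mu> t \<le> e"
proof -
  define c where "c = Min (walk_law 1 ` carrier G)"
  \<comment> \<open>What is left of the time-one law after removing the constant \<open>c\<close>;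
    its mass \<rho>, less than one, is the contraction factor of the l2 norm per unit of
    time.\<close>
  define r where "r = (\<lambda>x. walk_law 1 x - c)"
  have c: "0 < c" "\<And>x. x \<in> carrier G \<Longrightarrow> c \<le> walk_law 1 x"
    using pos by (simp_all add: c_def)
  define \<rho> where "\<rho> = sum r (carrier G)"
  have r: "\<And>x. x \<in> carrier G \<Longrightarrow> 0 \<le> r x" using c by (simp add: r_def)
  have "\<rho> = 1 - card (carrier G) * c"
    by (simp add: \<rho>_def r_def sum_subtractf sum_walk_law)
  then have \<rho>: "0 \<le> \<rho>" "\<rho> < 1" using sum_nonneg[of "carrier G" r] r c card_pos by (auto simp: \<rho>_def)
  define N where "N = (\<lambda>t. \<Sum>x\<in>carrier G. (excess t x)\<^sup>2)"
  have contract: "N (1 + t) \<le> \<rho>\<^sup>2 * N t" if t: "0 \<le> t" for t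
  proof -
    have "excess (1 + t) y = conv r (excess t) y" if y: "y \<in> carrier G" for y
    proof -
      have "(\<Sum>u\<in>carrier G. excess t (inv u \<otimes> y)) = 0"
        using sum.reindex_bij_betw[OF bij_betw_inv_mult[OF y], of "excess t"] sum_excess[OF t] by simp
      then have "conv r (excess t) y = conv (walk_law 1) (excess t) y"
        by (simp add: conv_def r_def left_diff_distrib sum_subtractf flip: sum_distrib_left)
      then show ?thesis using excess_add[of 1 t y] t y by simp
    qed
    then show ?thesis
      using sum_conv_squares_le[of r "excess t"] r by (simp add: N_def \<rho>_def)
  qed
  have N_nat: "N (real n) \<le> (\<rho>\<^sup>2) ^ n * N 0" for n
  proof (induction n)
    case (Suc n)
    have "N (real (Suc n)) \<le> \<rho>\<^sup>2 * N (real n)" using contract[of "real n"] by simp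
    also have "\<dots> \<le> \<rho>\<^sup>2 * ((\<rho>\<^sup>2) ^ n * N 0)" by (rule mult_left_mono[OF Suc]) simp
    finally show ?case by (simp add: mult.assoc)
  qed simp
  have "\<rho>\<^sup>2 < 1" using \<rho> by (simp add: power_less_one_iff abs_square_less_1)
  then have "(\<lambda>n. (\<rho>\<^sup>2) ^ n * N 0) \<longlonglongrightarrow> 0"
    by (intro tendsto_mult_left_zero LIMSEQ_realpow_zero) auto
  then have "eventually (\<lambda>n. (\<rho>\<^sup>2) ^ n * N 0 < e\<^sup>2 / card (carrier G)) sequentially"
    using e card_pos by (intro order_tendstoD(2)) auto
  then obtain n where "(\<rho>\<^sup>2) ^ n * N 0 < e\<^sup>2 / card (carrier G)"
    by (auto simp: eventually_sequentially)
  then have "N (real n) \<le> e\<^sup>2 / card (carrier G)" using N_nat[of n] by linarith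
  then have "card (carrier G) * N (real n) \<le> e\<^sup>2" using card_pos by (simp add: field_simps)
  then have "l2_dist_unif G \<mu> (real n) \<le> e"
    unfolding l2_dist_unif_eq N_def using e by (intro real_le_lsqrt) auto
  then show ?thesis by (intro exI[of _ "real n"]) simp
qed

subsection \<open>Push-forward and class decomposition\<close>

text \<open>The sum over \<open>G\<close> is grouped by fibres of \<phi>; the fibre over
  \<open>\<phi>(x)^-1 c\<close> is the translate by \<open>x^-1\<close> of the fibre over
  \<open>c\<close>.\<close>

lemma law_push_forward:
  assumes Q: "group Q" and hom: "\<phi> \<in> hom G Q" and surj: "\<phi> ` carrier G = carrier Q"
    and c: "c \<in> carrier Q"
  shows "jump_kernel_pow Q (map_pmf \<phi> \<mu>) m \<one>\<^bsub>Q\<^esub> c = (\<Sum>x\<in>{x \<in> carrier G. \<phi> x = c}. law m x)"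
  using c
proof (induction m arbitrary: c)
  case 0
  have "(\<Sum>x\<in>{x \<in> carrier G. \<phi> x = c}. law 0 x) = (\<Sum>x\<in>carrier G. if \<one> = x then if \<phi> x = c then 1 else 0 else 0)"
    by (simp add: sum.inter_filter cong: sum.cong)
  also have "\<dots> = (if \<phi> \<one> = c then 1 else 0)" by simp
  finally show ?case using hom_one[OF hom is_group Q] by simp
next
  case (Suc m)
  interpret Q: group Q by (rule Q)
  interpret group_hom G Q \<phi> by unfold_locales (rule hom)
  have finite_Q: "finite (carrier Q)" using surj finite_carrier by (metis finite_imageI)
  \<comment> \<open>\<open>pmf_map\<close> uses the preimage in the whole type; intersecting with
    the support of \<mu> confines it to the carrier.\<close>
  have pmf_eq: "pmf (map_pmf \<phi> \<mu>) c = (\<Sum>v\<in>{v \<in> carrier G. \<phi> v = c}. pmf \<mu> v)" for c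
  proof -
    have "pmf (map_pmf \<phi> \<mu>) c = measure_pmf.prob \<mu> {v \<in> carrier G. \<phi> v = c}"
      unfolding pmf_map using supp_subset
      by (subst measure_Int_set_pmf[symmetric], subst (2) measure_Int_set_pmf[symmetric])
        (intro arg_cong[where f = "measure \<mu>"], auto)
    then show ?thesis by (simp add: measure_measure_pmf_finite)
  qed
  have translate: "(\<Sum>v\<in>{v \<in> carrier G. \<phi> v = inv\<^bsub>Q\<^esub> \<phi> x \<otimes>\<^bsub>Q\<^esub> c}. pmf \<mu> v)
      = (\<Sum>y\<in>{y \<in> carrier G. \<phi> y = c}. pmf \<mu> (inv x \<otimes> y))" if x: "x \<in> carrier G" for x
    by (rule sum.reindex_bij_witness[of _ "\<lambda>y. inv x \<otimes> y" "\<lambda>v. x \<otimes> v"])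
      (use x Suc.prems in \<open>auto simp: group_normal_form Q.group_normal_form\<close>)
  have "jump_kernel_pow Q (map_pmf \<phi> \<mu>) (Suc m) \<one>\<^bsub>Q\<^esub> c
      = (\<Sum>z\<in>carrier Q. \<Sum>x\<in>{x \<in> carrier G. \<phi> x = z}. law m x *
          (\<Sum>v\<in>{v \<in> carrier G. \<phi> v = inv\<^bsub>Q\<^esub> \<phi> x \<otimes>\<^bsub>Q\<^esub> c}. pmf \<mu> v))"
    by (auto intro!: sum.cong simp: Suc.IH jump_kernel_def pmf_eq sum_distrib_right)
  also have "\<dots> = (\<Sum>x\<in>carrier G. law m x *
          (\<Sum>v\<in>{v \<in> carrier G. \<phi> v = inv\<^bsub>Q\<^esub> \<phi> x \<otimes>\<^bsub>Q\<^esub> c}. pmf \<mu> v))"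
    using surj by (intro sum.group finite_carrier finite_Q) auto
  also have "\<dots> = (\<Sum>x\<in>carrier G. law m x * (\<Sum>y\<in>{y \<in> carrier G. \<phi> y = c}. pmf \<mu> (inv x \<otimes> y)))"
    by (intro sum.cong refl) (simp add: translate)
  also have "\<dots> = (\<Sum>y\<in>{y \<in> carrier G. \<phi> y = c}. law (Suc m) y)"
    unfolding law_Suc conv_def by (simp add: sum_distrib_left) (rule sum.swap)
  finally show ?case .
qed

lemma group_walk_push_forward:
  assumes Q: "group Q" and hom: "\<phi> \<in> hom G Q" and surj: "\<phi> ` carrier G = carrier Q"
  shows "group_walk Q (map_pmf \<phi> \<mu>)"
proof -
  interpret Q: group Q by (rule Q)
  have "finite (carrier Q)" using surj finite_carrier by (metis finite_imageI)
  then show ?thesis using supp_subset surj by unfold_locales auto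
qed

lemma walk_law_push_forward:
  assumes Q: "group Q" and hom: "\<phi> \<in> hom G Q" and surj: "\<phi> ` carrier G = carrier Q"
    and t: "0 \<le> t" and c: "c \<in> carrier Q"
  shows "walk_kernel Q (map_pmf \<phi> \<mu>) t \<one>\<^bsub>Q\<^esub> c = (\<Sum>x\<in>{x \<in> carrier G. \<phi> x = c}. walk_law t x)"
proof -
  interpret Q: group_walk Q "map_pmf \<phi> \<mu>" by (rule group_walk_push_forward[OF Q hom surj])
  have "(\<lambda>m. \<Sum>x\<in>{x \<in> carrier G. \<phi> x = c}. poisson_weight t m * law m x)
      sums (\<Sum>x\<in>{x \<in> carrier G. \<phi> x = c}. walk_law t x)"
    by (intro sums_sum walk_law_sums) (use t in auto)
  then have "(\<lambda>m. poisson_weight t m * Q.law m c) sums (\<Sum>x\<in>{x \<in> carrier G. \<phi> x = c}. walk_law t x)"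
    by (simp add: law_push_forward[OF Q hom surj c] flip: sum_distrib_left)
  then show ?thesis using Q.walk_law_sums[OF t c] sums_unique2 by blast
qed

text \<open>Positivity at a given time passes directly to a quotient; this is what the Doeblin bound
  asks of the projected walk.\<close>

lemma walk_law_push_forward_pos:
  assumes Q: "group Q" and hom: "\<phi> \<in> hom G Q" and surj: "\<phi> ` carrier G = carrier Q"
    and t: "0 \<le> t" and pos: "\<And>x. x \<in> carrier G \<Longrightarrow> 0 < walk_law t x" and c: "c \<in> carrier Q"
  shows "0 < walk_kernel Q (map_pmf \<phi> \<mu>) t \<one>\<^bsub>Q\<^esub> c"
  unfolding walk_law_push_forward[OF Q hom surj t c]
  using c pos by (intro sum_pos) (auto simp flip: surj)

text \<open>Distributivity, one letter at a time. Jumps are appended on the right whereas words grow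
  on the left; the two agree because the class function \<open>pmf \<mu>\<close> is central.\<close>

lemma law_eq_sum_word_conv:
  assumes \<mu>: "class_function (pmf \<mu>)"
    and decomp: "\<And>x. x \<in> carrier G \<Longrightarrow> pmf \<mu> x = (\<Sum>a\<in>A. f a x)"
    and y: "y \<in> carrier G"
  shows "law m y = (\<Sum>w\<in>{w. set w \<subseteq> A \<and> length w = m}. word_conv f w y)"
  using y
proof (induction m arbitrary: y)
  case 0
  have "{w. set w \<subseteq> A \<and> length w = 0} = {[]}" by auto
  then show ?case by auto
next
  case (Suc m)
  have "law (Suc m) y = conv (pmf \<mu>) (law m) y"
    using Suc.prems by (simp add: law_Suc conv_commute[OF \<mu>] del: jump_kernel_pow.simps)
  also have "\<dots> = conv (\<lambda>x. \<Sum>a\<in>A. f a x) (\<lambda>x. \<Sum>w\<in>{w. set w \<subseteq> A \<and> length w = m}. word_conv f w x) y"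
    using Suc decomp by (intro conv_cong) auto
  also have "\<dots> = (\<Sum>w\<in>{w. set w \<subseteq> A \<and> length w = m}. \<Sum>a\<in>A. word_conv f (a # w) y)"
    by (simp add: conv_sum)
  also have "\<dots> = (\<Sum>w\<in>{w. set w \<subseteq> A \<and> length w = Suc m}. word_conv f w y)"
    unfolding lists_length_Suc_eq
    by (subst sum.reindex) (auto simp: inj_on_def sum.cartesian_product split_def)
  finally show ?case .
qed

text \<open>Words containing every letter contribute nothing, by \<open>full\<close>. Any other word
  contributes at most twice its mass and is charged to each letter that it misses; the words missing
  \<open>a\<close> have total mass \<open>(1 - p a) ^ m\<close>.\<close>

lemma sum_abs_law_diff_coset_average_le:
  assumes \<mu>: "class_function (pmf \<mu>)" and A: "finite A"
    and decomp: "\<And>x. x \<in> carrier G \<Longrightarrow> pmf \<mu> x = (\<Sum>a\<in>A. f a x)"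
    and f: "\<And>a x. a \<in> A \<Longrightarrow> x \<in> carrier G \<Longrightarrow> 0 \<le> f a x"
    and D: "D \<subseteq> carrier G" "card D \<noteq> 0"
    and full: "\<And>w d y. set w = A \<Longrightarrow> d \<in> D \<Longrightarrow> y \<in> carrier G \<Longrightarrow>
                  word_conv f w (d \<otimes> y) = word_conv f w y"
  shows "(\<Sum>x\<in>carrier G. \<bar>law m x - coset_average D (law m) x\<bar>)
          \<le> 2 * (\<Sum>a\<in>A. (1 - sum (f a) (carrier G)) ^ m)"
proof -
  define W where "W = {w. set w \<subseteq> A \<and> length w = m}"
  define p where "p = (\<lambda>a. sum (f a) (carrier G))"
  have finite_W: "finite W" unfolding W_def by (rule finite_lists_length_eq[OF A])
  have p: "0 \<le> p a" if "a \<in> A" for a unfolding p_def using f that by (auto intro: sum_nonneg)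
  have p_word: "0 \<le> (\<Prod>a\<leftarrow>w. p a)" if "set w \<subseteq> A" for w
    using that p by (induction w) auto
  have sum_p: "sum p A = 1"
    unfolding p_def using sum_pmf by (subst sum.swap) (simp add: decomp)
  have law_eq: "law m x = (\<Sum>w\<in>W. word_conv f w x)" if "x \<in> carrier G" for x
    unfolding W_def by (rule law_eq_sum_word_conv[OF \<mu> decomp that])
  have "(\<Sum>x\<in>carrier G. \<bar>law m x - coset_average D (law m) x\<bar>)
      = (\<Sum>x\<in>carrier G. \<bar>\<Sum>w\<in>W. word_conv f w x - coset_average D (word_conv f w) x\<bar>)"
  proof (rule sum.cong)
    fix x assume x: "x \<in> carrier G"
    have "coset_average D (law m) x = coset_average D (\<lambda>x. \<Sum>w\<in>W. word_conv f w x) x"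
      unfolding coset_average_def using D x by (auto intro!: sum.cong arg_cong2[where f = "(/)"] law_eq)
    then show "\<bar>law m x - coset_average D (law m) x\<bar>
      = \<bar>\<Sum>w\<in>W. word_conv f w x - coset_average D (word_conv f w) x\<bar>"
      using x by (simp add: law_eq coset_average_sum sum_subtractf)
  qed simp
  also have "\<dots> \<le> (\<Sum>x\<in>carrier G. \<Sum>w\<in>W. \<bar>word_conv f w x - coset_average D (word_conv f w) x\<bar>)"
    by (intro sum_mono sum_abs)
  also have "\<dots> = (\<Sum>w\<in>W. \<Sum>x\<in>carrier G. \<bar>word_conv f w x - coset_average D (word_conv f w) x\<bar>)"
    by (rule sum.swap)
  also have "\<dots> \<le> (\<Sum>w\<in>W. \<Sum>a\<in>A. if a \<notin> set w then 2 * (\<Prod>a\<leftarrow>w. p a) else 0)"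
  proof (rule sum_mono)
    fix w assume w: "w \<in> W"
    show "(\<Sum>x\<in>carrier G. \<bar>word_conv f w x - coset_average D (word_conv f w) x\<bar>)
        \<le> (\<Sum>a\<in>A. if a \<notin> set w then 2 * (\<Prod>a\<leftarrow>w. p a) else 0)"
    proof (cases "set w = A")
      case True
      have "coset_average D (word_conv f w) x = word_conv f w x" if "x \<in> carrier G" for x
        unfolding coset_average_def using full[OF True _ that] D by simp
      then have "(\<Sum>x\<in>carrier G. \<bar>word_conv f w x - coset_average D (word_conv f w) x\<bar>) = 0"
        by simp
      also have "\<dots> \<le> (\<Sum>a\<in>A. if a \<notin> set w then 2 * (\<Prod>a\<leftarrow>w. p a) else 0)"
        using w p_word[of w] by (intro sum_nonneg) (auto simp: W_def)
      finally show ?thesis .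
    next
      case False
      then obtain a where a: "a \<in> A" "a \<notin> set w" using w by (auto simp: W_def)
      have "(\<Sum>x\<in>carrier G. \<bar>word_conv f w x - coset_average D (word_conv f w) x\<bar>)
          \<le> 2 * sum (word_conv f w) (carrier G)"
        using w f by (intro sum_abs_diff_coset_average_le[OF D] word_conv_nonneg) (auto simp: W_def)
      also have "\<dots> = (if a \<notin> set w then 2 * (\<Prod>a\<leftarrow>w. p a) else 0)"
        using a by (simp add: sum_word_conv p_def)
      also have "\<dots> \<le> (\<Sum>a\<in>A. if a \<notin> set w then 2 * (\<Prod>a\<leftarrow>w. p a) else 0)"
        using w p_word[of w] by (intro member_le_sum[OF a(1) _ A]) (auto simp: W_def)
      finally show ?thesis .
    qed
  qed
  also have "\<dots> = (\<Sum>a\<in>A. \<Sum>w\<in>{w \<in> W. a \<notin> set w}. 2 * (\<Prod>a\<leftarrow>w. p a))"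
    by (subst sum.swap) (simp add: sum.inter_filter[OF finite_W])
  also have "\<dots> = (\<Sum>a\<in>A. 2 * (1 - p a) ^ m)"
  proof (rule sum.cong)
    fix a assume a: "a \<in> A"
    have "{w \<in> W. a \<notin> set w} = {w. set w \<subseteq> A - {a} \<and> length w = m}" by (auto simp: W_def)
    moreover have "sum p (A - {a}) = 1 - p a" using a A sum_p by (simp add: sum_diff1)
    ultimately show "(\<Sum>w\<in>{w \<in> W. a \<notin> set w}. 2 * (\<Prod>a\<leftarrow>w. p a)) = 2 * (1 - p a) ^ m"
      by (simp add: sum_prod_list_words flip: sum_distrib_left)
  qed simp
  finally show ?thesis by (simp add: p_def sum_distrib_left)
qed

lemma sum_abs_walk_law_diff_coset_average_le:
  assumes D: "D \<subseteq> carrier G"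
    and law: "\<And>m. (\<Sum>x\<in>carrier G. \<bar>law m x - coset_average D (law m) x\<bar>)
                \<le> 2 * (\<Sum>a\<in>A. (1 - p a) ^ m)"
    and t: "0 \<le> t"
  shows "(\<Sum>x\<in>carrier G. \<bar>walk_law t x - coset_average D (walk_law t) x\<bar>)
          \<le> 2 * (\<Sum>a\<in>A. exp (- (t * p a)))"
proof -
  define \<delta> where "\<delta> = (\<lambda>F x. F x - coset_average D F x)"
  \<comment> \<open>Signs frozen at time \<open>t\<close> make the l1 norm a linear functional, so
    that the series in \<open>m\<close> can be summed termwise; for each \<open>m\<close> the
    functional is at most the l1 norm.\<close>
  define \<sigma> where "\<sigma> = (\<lambda>x. sgn (\<delta> (walk_law t) x))"
  have \<delta>_sums: "(\<lambda>m. poisson_weight t m * \<delta> (law m) x) sums \<delta> (walk_law t) x" if x: "x \<in> carrier G" for x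
  proof -
    have "(\<lambda>m. poisson_weight t m * law m x - (\<Sum>d\<in>D. poisson_weight t m * law m (d \<otimes> x)) / card D)
        sums (walk_law t x - (\<Sum>d\<in>D. walk_law t (d \<otimes> x)) / card D)"
      using D x t by (intro sums_diff sums_divide sums_sum walk_law_sums) auto
    then show ?thesis
      by (simp add: \<delta>_def coset_average_def right_diff_distrib flip: sum_distrib_left)
  qed
  have "(\<lambda>m. \<Sum>x\<in>carrier G. \<sigma> x * (poisson_weight t m * \<delta> (law m) x))
      sums (\<Sum>x\<in>carrier G. \<sigma> x * \<delta> (walk_law t) x)"
    by (intro sums_sum sums_mult \<delta>_sums)
  moreover have "(\<Sum>x\<in>carrier G. \<sigma> x * \<delta> (walk_law t) x) = (\<Sum>x\<in>carrier G. \<bar>\<delta> (walk_law t) x\<bar>)"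
    by (simp add: \<sigma>_def abs_sgn mult.commute)
  ultimately have lhs: "(\<lambda>m. poisson_weight t m * (\<Sum>x\<in>carrier G. \<sigma> x * \<delta> (law m) x))
      sums (\<Sum>x\<in>carrier G. \<bar>\<delta> (walk_law t) x\<bar>)"
    by (simp add: sum_distrib_left mult_ac)
  have rhs: "(\<lambda>m. \<Sum>a\<in>A. 2 * (poisson_weight t m * (1 - p a) ^ m))
      sums (\<Sum>a\<in>A. 2 * exp (- (t * (1 - (1 - p a)))))"
    by (intro sums_sum sums_mult poisson_weight_power_sums)
  have le: "poisson_weight t m * (\<Sum>x\<in>carrier G. \<sigma> x * \<delta> (law m) x)
      \<le> (\<Sum>a\<in>A. 2 * (poisson_weight t m * (1 - p a) ^ m))" for m
  proof -
    have "(\<Sum>x\<in>carrier G. \<sigma> x * \<delta> (law m) x) \<le> (\<Sum>x\<in>carrier G. \<bar>\<delta> (law m) x\<bar>)"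
      by (intro sum_mono) (auto simp: \<sigma>_def sgn_if)
    also have "\<dots> \<le> 2 * (\<Sum>a\<in>A. (1 - p a) ^ m)" using law by (simp add: \<delta>_def)
    finally have "poisson_weight t m * (\<Sum>x\<in>carrier G. \<sigma> x * \<delta> (law m) x)
        \<le> poisson_weight t m * (2 * (\<Sum>a\<in>A. (1 - p a) ^ m))"
      by (rule mult_left_mono) (rule poisson_weight_nonneg[OF t])
    then show ?thesis by (simp add: sum_distrib_left mult_ac)
  qed
  from sums_le[OF le lhs rhs] show ?thesis by (simp add: \<delta>_def sum_distrib_left)
qed

subsection \<open>Comparison with the abelianization\<close>

text \<open>The law after \<open>m\<close> jumps lives on products of \<open>m\<close> elements of
  the support, and irreducibility makes every element such a product. The form is the one asked for
  by \<open>gen\<close> in \<open>derived_translate_class_function\<close>.\<close>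

lemma walk_law_support_closed:
  assumes "\<one> \<in> K" and "\<And>x u. x \<in> K \<Longrightarrow> x \<in> carrier G \<Longrightarrow> u \<in> set_pmf \<mu> \<Longrightarrow> x \<otimes> u \<in> K"
    and irr: "irreducible_walk G \<mu>"
  shows "carrier G \<subseteq> K"
proof
  fix y assume y: "y \<in> carrier G"
  have "y \<in> K" if "law m y \<noteq> 0" "y \<in> carrier G" for m
    using that
  proof (induction m arbitrary: y)
    case 0
    then show ?case using assms(1) by (auto split: if_splits)
  next
    case (Suc m)
    then obtain z where z: "z \<in> carrier G" "law m z * pmf \<mu> (inv z \<otimes> y) \<noteq> 0"
      unfolding law_Suc conv_def by (elim sum.not_neutral_contains_not_neutral)
    then have "z \<in> K" "inv z \<otimes> y \<in> set_pmf \<mu>" using Suc.IH[of z] by (auto simp: set_pmf_iff)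
    then have "z \<otimes> (inv z \<otimes> y) \<in> K" using assms(2) z by blast
    then show ?case using z Suc.prems by (simp add: group_normal_form)
  qed
  then show "y \<in> K" using irreducible_walk_law_pos[OF irr y] y by (metis less_irrefl)
qed

section \<open>Cosets of the commutator subgroup\<close>

abbreviation (input) G' where "G' \<equiv> derived G (carrier G)"

lemma derived_normal: "G' \<lhd> G"
  by (rule derived_self_is_normal)

lemma derived_subgroup: "subgroup G' G"
  by (rule normal_imp_subgroup[OF derived_normal])

lemma derived_subset: "G' \<subseteq> carrier G"
  by (rule subgroup.subset[OF derived_subgroup])

lemma card_derived: "card G' \<noteq> 0"
  using subgroup.one_closed[OF derived_subgroup] finite_subset[OF derived_subset finite_carrier]
    card_0_eq by blast

lemma group_abelianization: "group (abelianization G)"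
  unfolding abelianization_def by (rule normal.factorgroup_is_group[OF derived_normal])

lemma hom_abelianization: "(\<lambda>x. G' #> x) \<in> hom G (abelianization G)"
  unfolding abelianization_def by (rule normal.r_coset_hom_Mod[OF derived_normal])

lemma surj_abelianization: "(\<lambda>x. G' #> x) ` carrier G = carrier (abelianization G)"
  unfolding abelianization_def by (rule carrier_FactGroup[symmetric])

lemmas abelianization_map = group_abelianization hom_abelianization surj_abelianization

lemma group_walk_abelianization: "group_walk (abelianization G) (ab_dist G \<mu>)"
  unfolding ab_dist_def by (rule group_walk_push_forward[OF abelianization_map])

lemma card_abelianization: "card (carrier (abelianization G)) * card G' = card (carrier G)"
  using lagrange[OF derived_subgroup] by (simp add: abelianization_def FactGroup_def Coset.order_def)

lemma coset_map_fibre: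
  assumes x: "x \<in> carrier G"
  shows "{y \<in> carrier G. G' #> y = G' #> x} = G' #> x"
  using x repr_independence[OF _ x derived_subgroup] rcos_self[OF _ derived_subgroup]
    r_coset_subset_G[OF derived_subset x] by blast

lemma sum_right_coset:
  fixes g :: "'a \<Rightarrow> real"
  assumes x: "x \<in> carrier G"
  shows "sum g (G' #> x) = (\<Sum>d\<in>G'. g (d \<otimes> x))"
proof -
  have "G' #> x = (\<lambda>d. d \<otimes> x) ` G'" by (auto simp: r_coset_def)
  moreover have "inj_on (\<lambda>d. d \<otimes> x) G'"
    using x derived_subset by (auto simp: inj_on_def subset_iff)
  ultimately show ?thesis by (simp add: sum.reindex)
qed

lemma sum_abelianization:
  fixes g :: "'a set \<Rightarrow> real"
  shows "card G' * (\<Sum>c\<in>carrier (abelianization G). g c) = (\<Sum>x\<in>carrier G. g (G' #> x))"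
proof -
  have "(\<Sum>x\<in>carrier G. g (G' #> x))
      = (\<Sum>c\<in>carrier (abelianization G). \<Sum>x\<in>{x \<in> carrier G. G' #> x = c}. g (G' #> x))"
    using group_walk.finite_carrier[OF group_walk_abelianization] surj_abelianization
    by (intro sum.group[symmetric]) auto
  also have "\<dots> = (\<Sum>c\<in>carrier (abelianization G). card G' * g c)"
  proof (rule sum.cong)
    fix c assume "c \<in> carrier (abelianization G)"
    then obtain x where x: "x \<in> carrier G" "c = G' #> x" by (auto simp flip: surj_abelianization)
    have "card {y \<in> carrier G. G' #> y = c} = card G'"
      using sum_right_coset[OF x(1), of "\<lambda>_. 1"] x by (simp add: coset_map_fibre)
    moreover have "(\<Sum>y\<in>{y \<in> carrier G. G' #> y = c}. g (G' #> y))
        = (\<Sum>y\<in>{y \<in> carrier G. G' #> y = c}. g c)"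
      by (intro sum.cong) auto
    ultimately show "(\<Sum>y\<in>{y \<in> carrier G. G' #> y = c}. g (G' #> y)) = card G' * g c" by simp
  qed simp
  finally show ?thesis by (simp add: sum_distrib_left)
qed

lemma coset_average_excess:
  "coset_average G' (excess t) x = coset_average G' (walk_law t) x - uniform_mass G x"
  using card_derived
  by (simp add: coset_average_def excess_def sum_subtractf diff_divide_distrib uniform_mass_def)

text \<open>On a coset the projected deviation is \<open>card G'\<close> times the average, and the
  coset has \<open>card G'\<close> points, so the two l1 sums agree.\<close>

lemma tv_dist_unif_abelianization:
  assumes t: "0 \<le> t"
  shows "tv_dist_unif (abelianization G) (ab_dist G \<mu>) t
    = (\<Sum>x\<in>carrier G. \<bar>coset_average G' (excess t) x\<bar>) / 2"
proof -
  interpret Q: group_walk "abelianization G" "ab_dist G \<mu>" by (rule group_walk_abelianization)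
  have "Q.excess t (G' #> x) = card G' * coset_average G' (excess t) x" if x: "x \<in> carrier G" for x
  proof -
    have c: "G' #> x \<in> carrier (abelianization G)" using x surj_abelianization by auto
    have "Q.walk_law t (G' #> x) = (\<Sum>y\<in>G' #> x. walk_law t y)"
      using walk_law_push_forward[OF abelianization_map t c] coset_map_fibre[OF x]
      by (simp add: ab_dist_def)
    then have "Q.walk_law t (G' #> x) = card G' * coset_average G' (walk_law t) x"
      using card_derived x by (simp add: coset_average_def sum_right_coset)
    moreover have "uniform_mass (abelianization G) (G' #> x) = card G' * uniform_mass G x"
      using card_derived by (simp add: uniform_mass_def flip: card_abelianization)
    ultimately show ?thesis
      unfolding coset_average_excess Q.excess_def by (simp add: right_diff_distrib)
  qed
  then have "card G' * (\<Sum>c\<in>carrier (abelianization G). \<bar>Q.excess t c\<bar>)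
      = card G' * (\<Sum>x\<in>carrier G. \<bar>coset_average G' (excess t) x\<bar>)"
    unfolding sum_abelianization by (simp add: abs_mult sum_distrib_left)
  then show ?thesis using card_derived by (simp add: Q.tv_dist_unif_eq)
qed

text \<open>Averaging contracts the l1 norm, by the triangle inequality within each coset.\<close>

lemma tv_dist_unif_abelianization_le:
  assumes t: "0 \<le> t"
  shows "tv_dist_unif (abelianization G) (ab_dist G \<mu>) t \<le> tv_dist_unif G \<mu> t"
proof -
  have "(\<Sum>x\<in>carrier G. \<bar>coset_average G' (excess t) x\<bar>)
      \<le> (\<Sum>x\<in>carrier G. coset_average G' (\<lambda>x. \<bar>excess t x\<bar>) x)"
    unfolding coset_average_def by (intro sum_mono) (simp add: divide_right_mono)
  also have "\<dots> = (\<Sum>x\<in>carrier G. \<bar>excess t x\<bar>)"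
    by (rule sum_coset_average[OF derived_subset card_derived])
  finally show ?thesis unfolding tv_dist_unif_abelianization[OF t] tv_dist_unif_eq by simp
qed

text \<open>The deviation splits into its coset average and a remainder, in which the uniform parts
  cancel.\<close>

lemma tv_dist_unif_le_abelianization:
  assumes t: "0 \<le> t"
  shows "tv_dist_unif G \<mu> t \<le> tv_dist_unif (abelianization G) (ab_dist G \<mu>) t
    + (\<Sum>x\<in>carrier G. \<bar>walk_law t x - coset_average G' (walk_law t) x\<bar>) / 2"
proof -
  have "(\<Sum>x\<in>carrier G. \<bar>excess t x\<bar>)
      \<le> (\<Sum>x\<in>carrier G. \<bar>coset_average G' (excess t) x\<bar>
            + \<bar>walk_law t x - coset_average G' (walk_law t) x\<bar>)"
    unfolding coset_average_excess by (intro sum_mono) (simp add: excess_def)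
  then show ?thesis
    unfolding tv_dist_unif_abelianization[OF t] tv_dist_unif_eq by (simp add: sum.distrib)
qed

lemma tv_dist_unif_nilpotent_le:
  assumes nil: "nilpotent_group G" and \<mu>: "class_function (pmf \<mu>)" and irr: "irreducible_walk G \<mu>"
    and S: "S \<subseteq> set_pmf \<mu>"
    and transversal: "\<And>x. x \<in> set_pmf \<mu> \<Longrightarrow> \<exists>!s. s \<in> S \<and> x \<in> conj_class G s"
    and t: "0 \<le> t"
  shows "tv_dist_unif G \<mu> t \<le> tv_dist_unif (abelianization G) (ab_dist G \<mu>) t
    + (\<Sum>s\<in>S. exp (- (t * measure_pmf.prob \<mu> (conj_class G s))))"
proof -
  define f where "f = (\<lambda>s u. if u \<in> conj_class G s then pmf \<mu> u else 0)"
  have SG: "S \<subseteq> carrier G" using S supp_subset by auto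
  have finS: "finite S" by (rule finite_subset[OF SG finite_carrier])
  have f_class: "class_function (f s)" if "s \<in> S" for s
    using that SG \<mu> conj_class_conj[of _ _ s] unfolding class_function_def f_def by auto
  have mass: "sum (f s) (carrier G) = measure_pmf.prob \<mu> (conj_class G s)" if "s \<in> S" for s
  proof -
    have sub: "conj_class G s \<subseteq> carrier G" using that SG conj_class_subset by auto
    then have "measure_pmf.prob \<mu> (conj_class G s) = sum (pmf \<mu>) (conj_class G s)"
      by (intro measure_measure_pmf_finite) (rule finite_subset[OF _ finite_carrier])
    also have "\<dots> = sum (f s) (carrier G)"
      using sub unfolding f_def by (simp add: sum.inter_restrict[symmetric] Int_absorb1)
    finally show ?thesis by simp
  qed
  have decomp: "pmf \<mu> x = (\<Sum>s\<in>S. f s x)" if "x \<in> carrier G" for x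
  proof (cases "x \<in> set_pmf \<mu>")
    case True
    then obtain s where s: "s \<in> S" "\<And>s'. s' \<in> S \<Longrightarrow> x \<in> conj_class G s' \<longleftrightarrow> s' = s"
      using transversal[OF True] by metis
    have "(\<Sum>s'\<in>S. f s' x) = (\<Sum>s'\<in>S. if s' = s then pmf \<mu> x else 0)"
      by (intro sum.cong) (auto simp: f_def s)
    then show ?thesis using s finS by simp
  next
    case False
    then have "f s x = 0" for s by (simp add: f_def set_pmf_iff)
    then show ?thesis using False by (simp add: set_pmf_iff)
  qed
  have full: "word_conv f w (d \<otimes> y) = word_conv f w y"
    if w: "set w = S" and d: "d \<in> G'" and y: "y \<in> carrier G" for w d y
  proof (rule derived_translate_class_function[OF finite_carrier nil _ supp_subset _ _ d y])
    show "class_function (word_conv f w)" using f_class w by (intro class_function_word_conv) auto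
  next
    fix K assume "\<one> \<in> K" "\<And>x u. x \<in> K \<Longrightarrow> x \<in> carrier G \<Longrightarrow> u \<in> set_pmf \<mu> \<Longrightarrow> x \<otimes> u \<in> K"
    then show "carrier G \<subseteq> K" using irr by (intro walk_law_support_closed)
  next
    \<comment> \<open>A factor is required for every \<open>u\<close> in the support, not just for
      representatives; the class of \<open>u\<close> is that of its representative \<open>s\<close>,
      whose factor serves.\<close>
    fix u assume "u \<in> set_pmf \<mu>"
    then obtain s where s: "s \<in> S" "u \<in> conj_class G s" using transversal by blast
    then obtain R where R: "\<And>y. y \<in> carrier G \<Longrightarrow> word_conv f w y = conv (f s) R y"
      using word_conv_factor[of s w f] f_class w by blast
    have "conj_class G u = conj_class G s" using s SG by (intro conj_class_eq) auto
    then show "\<exists>f' R. class_function f' \<and> (\<forall>v\<in>carrier G. f' v \<noteq> 0 \<longrightarrow> v \<in> conj_class G u)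
        \<and> (\<forall>y\<in>carrier G. word_conv f w y = conv f' R y)"
      using R f_class[OF s(1)] by (intro exI[of _ "f s"] exI[of _ R]) (auto simp: f_def)
  qed
  have "(\<Sum>x\<in>carrier G. \<bar>walk_law t x - coset_average G' (walk_law t) x\<bar>)
      \<le> 2 * (\<Sum>s\<in>S. exp (- (t * sum (f s) (carrier G))))"
    by (intro sum_abs_walk_law_diff_coset_average_le[OF derived_subset _ t]
        sum_abs_law_diff_coset_average_le[OF \<mu> finS decomp _ derived_subset card_derived full])
      (auto simp: f_def)
  also have "\<dots> = 2 * (\<Sum>s\<in>S. exp (- (t * measure_pmf.prob \<mu> (conj_class G s))))"
    by (simp add: mass)
  finally show ?thesis using tv_dist_unif_le_abelianization[OF t] by linarith
qed

end

section \<open>From distances to mixing times\<close>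

theorem theorem1p1:
  fixes G :: "('a, 'b) monoid_scheme" (structure)
    and \<mu> :: "'a pmf" and S :: "'a set" and k :: nat and \<mu>min \<epsilon> :: real
  assumes "group G" and "finite (carrier G)" and "nilpotent_group G"
    and "set_pmf \<mu> \<subseteq> carrier G"
    and "\<And>x z. x \<in> carrier G \<Longrightarrow> z \<in> carrier G \<Longrightarrow> pmf \<mu> (inv z \<otimes> x \<otimes> z) = pmf \<mu> x"
    and "irreducible_walk G \<mu>"
    and "S \<subseteq> set_pmf \<mu>"
    and "\<And>C. C \<in> conj_class G ` carrier G \<Longrightarrow> C \<subseteq> set_pmf \<mu> \<Longrightarrow> \<exists>!s. s \<in> S \<inter> C"
    and "k = card S"
    and "\<mu>min = (MIN s\<in>S. measure_pmf.prob \<mu> (conj_class G s))"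
    and "0 < \<epsilon>" and "\<epsilon> < 1"
  shows "tv_mixing_time (abelianization G) (ab_dist G \<mu>) \<epsilon> \<le> tv_mixing_time G \<mu> \<epsilon>
    \<and> tv_mixing_time G \<mu> \<epsilon>
        \<le> max (l2_mixing_time (abelianization G) (ab_dist G \<mu>) (\<epsilon> / 2))
              (inverse \<mu>min * (ln (real k) + 2 * ln (4 / \<epsilon>)))"
proof -
  interpret group_walk G \<mu>
    using assms(1,2,4) by (simp add: group_walk_def group_walk_axioms_def)
  interpret Q: group_walk "abelianization G" "ab_dist G \<mu>" by (rule group_walk_abelianization)
  note irr = assms(6) and S = assms(7) and \<epsilon> = assms(11,12)
  have \<mu>: "class_function (pmf \<mu>)" using assms(5) by (simp add: class_function_def)
  have SG: "S \<subseteq> carrier G" using S supp_subset by auto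
  have finS: "finite S" by (rule finite_subset[OF SG finite_carrier])
  \<comment> \<open>The hypothesis picks one representative from each class inside the support. By
    conjugacy invariance the class of \<open>x\<close> lies inside, and being conjugate is
    symmetric.\<close>
  have transversal: "\<exists>!s. s \<in> S \<and> x \<in> conj_class G s" if x: "x \<in> set_pmf \<mu>" for x
  proof -
    have xG: "x \<in> carrier G" using x supp_subset by auto
    have "conj_class G x \<subseteq> set_pmf \<mu>"
      using x xG assms(5) by (auto simp: conj_class_def set_pmf_iff)
    then have "\<exists>!s. s \<in> S \<inter> conj_class G x" using assms(8) xG by blast
    moreover have "s \<in> conj_class G x \<longleftrightarrow> x \<in> conj_class G s" if "s \<in> S" for s
    proof -
      have "s \<in> carrier G" using that SG by auto
      then show ?thesis
        using conj_class_eq[of s x] conj_class_eq[of x s] conj_class_self[of s] conj_class_self[of x] xG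
        by metis
    qed
    ultimately show ?thesis by (metis Int_iff)
  qed
  have "S \<noteq> {}" using transversal set_pmf_not_empty[of \<mu>] by blast
  then have k: "1 \<le> real k" using finS assms(9) by (simp add: Suc_le_eq card_gt_0_iff)
  have \<mu>min_le: "\<mu>min \<le> measure_pmf.prob \<mu> (conj_class G s)" if "s \<in> S" for s
    using that finS by (simp add: assms(10))
  have "0 < measure_pmf.prob \<mu> (conj_class G s)" if "s \<in> S" for s
    using that S SG conj_class_self[of s] by (intro measure_pmf_posI[of s]) auto
  then have \<mu>min: "0 < \<mu>min" using finS \<open>S \<noteq> {}\<close> by (simp add: assms(10))
  define L where "L = {t. 0 \<le> t \<and> l2_dist_unif (abelianization G) (ab_dist G \<mu>) t \<le> \<epsilon> / 2}"
  define T where "T = max (l2_mixing_time (abelianization G) (ab_dist G \<mu>) (\<epsilon> / 2))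
              (inverse \<mu>min * (ln (real k) + 2 * ln (4 / \<epsilon>)))"
  \<comment> \<open>Leads to \<open>L\<close> being nonempty, without which its infimum would carry
    no information.\<close>
  have "0 < Q.walk_law 1 c" if "c \<in> carrier (abelianization G)" for c
    unfolding ab_dist_def
    by (rule walk_law_push_forward_pos[OF abelianization_map _ _ that])
      (auto intro: walk_law_pos[OF irr])
  then have L_nonempty: "L \<noteq> {}"
    using Q.exists_l2_dist_unif_le[of "\<epsilon> / 2"] \<epsilon> by (auto simp: L_def)
  have T_nonneg: "0 \<le> T"
    unfolding T_def using \<mu>min k \<epsilon> by (intro max.coboundedI2 mult_nonneg_nonneg add_nonneg_nonneg) auto
  have tv_le: "tv_dist_unif G \<mu> t \<le> \<epsilon>" if t: "T < t" for t
  proof -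
    \<comment> \<open>Because \<open>T < t\<close> is strict, an actual element of \<open>L\<close>
      lies below \<open>t\<close>, whether or not the infimum is attained.\<close>
    have "Inf L < t" using t by (simp add: T_def l2_mixing_time_def L_def)
    then obtain s where s: "s \<in> L" "s < t" using cInf_lessD[OF L_nonempty] by blast
    then have "l2_dist_unif (abelianization G) (ab_dist G \<mu>) t \<le> \<epsilon> / 2"
      using Q.l2_dist_unif_antimono[of s t] by (auto simp: L_def)
    then have ab: "tv_dist_unif (abelianization G) (ab_dist G \<mu>) t \<le> \<epsilon> / 4"
      using Q.tv_dist_unif_le_l2[of t] by linarith
    \<comment> \<open>The second entry of the maximum makes the exponential at most
      \<open>(\<epsilon> / 4)^2 / k\<close>, which offsets the number of classes;
      \<open>\<epsilon> < 1\<close> then gives a second share of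
      \<open>\<epsilon> / 4\<close>.\<close>
    have "ln (real k) + 2 * ln (4 / \<epsilon>) \<le> t * \<mu>min"
      using t \<mu>min by (simp add: T_def field_simps)
    then have "real k * exp (- (t * \<mu>min)) \<le> real k * exp (- (ln (real k) + 2 * ln (4 / \<epsilon>)))"
      by (intro mult_left_mono) auto
    also have "ln (real k) + 2 * ln (4 / \<epsilon>) = ln (real k * (4 / \<epsilon>)\<^sup>2)"
      using k \<epsilon> by (simp add: ln_mult ln_realpow)
    also have "real k * exp (- ln (real k * (4 / \<epsilon>)\<^sup>2)) = (\<epsilon> / 4)\<^sup>2"
      using k \<epsilon> by (simp add: exp_minus power2_eq_square field_simps)
    also have "\<dots> \<le> \<epsilon> / 4" using \<epsilon> by (simp add: power2_eq_square field_simps)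
    finally have rest: "real k * exp (- (t * \<mu>min)) \<le> \<epsilon> / 4" .
    have "(\<Sum>s\<in>S. exp (- (t * measure_pmf.prob \<mu> (conj_class G s)))) \<le> (\<Sum>s\<in>S. exp (- (t * \<mu>min)))"
      using \<mu>min_le t T_nonneg by (intro sum_mono) (auto intro: mult_left_mono)
    also have "\<dots> \<le> \<epsilon> / 4" using rest by (simp add: assms(9))
    finally show ?thesis
      using tv_dist_unif_nilpotent_le[OF assms(3) \<mu> irr S transversal, of t] t T_nonneg ab \<epsilon> by simp
  qed
  \<comment> \<open>Every \<open>t > T\<close> belongs to the set, so its infimum is at most each
    such \<open>t\<close> and hence at most \<open>T\<close>.\<close>
  have "tv_mixing_time G \<mu> \<epsilon> \<le> T"
    unfolding tv_mixing_time_def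
    by (rule dense_ge, rule cInf_lower)
      (use tv_le T_nonneg in \<open>auto intro: bdd_belowI[of _ 0]\<close>)
  \<comment> \<open>A smaller distance on the quotient gives a larger set of times; comparing infima
    also needs the set for \<open>G\<close> to be nonempty, which \<open>tv_le\<close> provides at
    \<open>T + 1\<close>.\<close>
  moreover have "tv_mixing_time (abelianization G) (ab_dist G \<mu>) \<epsilon> \<le> tv_mixing_time G \<mu> \<epsilon>"
    unfolding tv_mixing_time_def
  proof (rule cInf_superset_mono)
    show "{t. 0 \<le> t \<and> tv_dist_unif G \<mu> t \<le> \<epsilon>} \<noteq> {}"
      using tv_le[of "T + 1"] T_nonneg by (auto intro!: exI[of _ "T + 1"])
    show "bdd_below {t. 0 \<le> t \<and> tv_dist_unif (abelianization G) (ab_dist G \<mu>) t \<le> \<epsilon>}"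
      by (rule bdd_belowI[of _ 0]) auto
    show "{t. 0 \<le> t \<and> tv_dist_unif G \<mu> t \<le> \<epsilon>}
        \<subseteq> {t. 0 \<le> t \<and> tv_dist_unif (abelianization G) (ab_dist G \<mu>) t \<le> \<epsilon>}"
      using tv_dist_unif_abelianization_le by force
  qed
  ultimately show ?thesis by (simp add: T_def)
qed

end
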